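(* There is a universal constant $C_0>0$ such that for every constant $C\ge C_0$ there exist constants $c,c'>0$ (depending only on $C$, not on $p,n,s,\theta,z,\kappa$) for which the following holds. Let $X_1,\dots,X_n\in\mathbb{R}^p$ be generated from the sparse two-cluster model with parameters $\theta\in\mathbb{R}^p\setminus\{0\}$, $\|\theta\|_0\le s$, and $z\in\{-1,1\}^n$. Assume that $\log(p)\le n$ and $\|\theta\|_\infty\le\kappa\le\sqrt{\log(p)}$ for some $\kappa>0$, that $\lambda=C(1+\kappa)\sqrt{\log(p)/n}$, and that $$\frac{s^2\log(p)(1+\kappa^2)}{n\|\theta\|^4}=:\tau_n^2\le c .$$ Then the output $\hat z$ of the sparse spectral clustering algorithm with tuning parameter $\lambda$ satisfies, with probability at least $1-8p^{-1}-2e^{-\|\theta\|/2}$, $$\ell(\hat z,z):=\min_{\pi\in\{-1,1\}}\frac1n\sum_{i=1}^n\mathbf{1}(\pi\hat z_i\ne z_i)\le 2\exp\left(-\frac{\|\theta\|^2}{2}\left(1-c'\tau_n-\|\theta\|^{-1}\right)\right).$$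
   Context: Model: for fixed $\theta\in\mathbb{R}^p$ with at most $s$ nonzero entries ($\|\theta\|_0\le s$) and fixed $z\in\{-1,1\}^n$, one observes $X_i=z_i\theta+\varepsilon_i$, $i=1,\dots,n$, with $\varepsilon_i$ i.i.d. $\mathcal{N}(0,I_p)$. $X=[X_1,\dots,X_n]\in\mathbb{R}^{p\times n}$ is the data matrix. Notation: $\|v\|$ is the Euclidean norm and $\|v\|_\infty$ the maximum norm of a vector; for a matrix $A$, $\|A\|_1=\sum_{i,j}|A_{ij}|$ is the entrywise $\ell^1$-norm; $\langle A,B\rangle=\mathrm{tr}(A^TB)$; $\mathrm{sgn}(x)=\mathbf{1}(x>0)-\mathbf{1}(x\le0)$. Sparse spectral clustering algorithm (input $X$ and tuning parameter $\lambda$; output $\hat z\in\{-1,1\}^n$): (1) compute $\hat P\in\arg\max_{P\in\mathcal{F}^1}\left\langle \frac{XX^T}{n},P\right\rangle-\lambda\|P\|_1$, where $\mathcal{F}^1=\{P\in\mathbb{R}^{p\times p}: P^T=P,\ \mathrm{tr}(P)=1,\ 0\preceq P\preceq I\}$; (2) compute a leading (unit) eigenvector $\hat u$ of $\hat P$; (3) set $\hat Y=\hat u^TX\in\mathbb{R}^n$ and return $\hat z_i=\mathrm{sgn}(\hat Y_i)$, $i=1,\dots,n$. *)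

theory Defs
  imports "HOL-Probability.Probability" "Jordan_Normal_Form.Char_Poly"
begin

unbundle no vec_syntax
unbundle no inner_syntax
hide_const (open) Finite_Cartesian_Product.mat Finite_Cartesian_Product.vec
  Finite_Cartesian_Product.row Finite_Cartesian_Product.column Determinants.det
  Finite_Cartesian_Product.transpose

text \<open>
  The dimensions \<open>p\<close> and \<open>n\<close> are quantified inside the theorem (after the constants), so vectors
  and matrices are those of Jordan-Normal-Form, with explicit dimensions.  Indices start at 0:
  row \<open>j < p\<close>, column (observation) \<open>i < n\<close>.
\<close>

definition vnorm :: "real vec \<Rightarrow> real" where
  "vnorm v = sqrt (v \<bullet> v)"

definition norm_0 :: "real vec \<Rightarrow> nat" where
  "norm_0 v = card {j. j < dim_vec v \<and> v $ j \<noteq> 0}"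

text \<open>Only meaningful for vectors of positive dimension.\<close>

definition norm_inf :: "real vec \<Rightarrow> real" where
  "norm_inf v = Max ((\<lambda>j. \<bar>v $ j\<bar>) ` {..<dim_vec v})"

definition mat_norm_1 :: "real mat \<Rightarrow> real" where
  "mat_norm_1 A = (\<Sum>i<dim_row A. \<Sum>j<dim_col A. \<bar>A $$ (i, j)\<bar>)"

definition mat_tr :: "real mat \<Rightarrow> real" where
  "mat_tr A = (\<Sum>i<dim_row A. A $$ (i, i))"

definition mat_inner :: "real mat \<Rightarrow> real mat \<Rightarrow> real" where
  "mat_inner A B = mat_tr (transpose_mat A * B)"

text \<open>The Loewner order, to be used for symmetric \<open>A\<close> and \<open>B\<close> of the same size.\<close>

definition loewner_le :: "real mat \<Rightarrow> real mat \<Rightarrow> bool" where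
  "loewner_le A B \<longleftrightarrow> (\<forall>v \<in> carrier_vec (dim_row A). 0 \<le> v \<bullet> ((B - A) *\<^sub>v v))"

definition fantope1 :: "nat \<Rightarrow> real mat set" where
  "fantope1 p = {P \<in> carrier_mat p p. transpose_mat P = P \<and> mat_tr P = 1 \<and>
     loewner_le (0\<^sub>m p p) P \<and> loewner_le P (1\<^sub>m p)}"

text \<open>Unlike \<^const>\<open>sgn\<close>, this takes the value \<open>-1\<close> at \<open>0\<close>.\<close>

definition sgn_pm :: "real \<Rightarrow> real" where
  "sgn_pm x = of_bool (x > 0) - of_bool (x \<le> 0)"

definition leading_unit_eigenvector :: "real mat \<Rightarrow> real vec \<Rightarrow> bool" where
  "leading_unit_eigenvector A u \<longleftrightarrow> vnorm u = 1 \<and>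
     (\<exists>k. eigenvector A u k \<and> (\<forall>k'. eigenvalue A k' \<longrightarrow> k' \<le> k))"

text \<open>
  Neither the maximiser nor the leading eigenvector need be unique, so the algorithm is a relation:
  \<open>ssc_output lam X zh\<close> holds if \<open>zh\<close> arises from some admissible choice in steps (1) and (2).
\<close>

definition ssc_output :: "real \<Rightarrow> real mat \<Rightarrow> real vec \<Rightarrow> bool" where
  "ssc_output lam X zh \<longleftrightarrow> (\<exists>P u.
     is_arg_max (\<lambda>Q. mat_inner ((1 / real (dim_col X)) \<cdot>\<^sub>m (X * transpose_mat X)) Q
                      - lam * mat_norm_1 Q)
       (\<lambda>Q. Q \<in> fantope1 (dim_row X)) P \<and>
     leading_unit_eigenvector P u \<and>
     zh = map_vec sgn_pm (transpose_mat X *\<^sub>v u))"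

definition clustering_loss :: "real vec \<Rightarrow> real vec \<Rightarrow> real" where
  "clustering_loss zh z =
     Min ((\<lambda>\<pi>. 1 / real (dim_vec z) * (\<Sum>i<dim_vec z. of_bool (\<pi> * zh $ i \<noteq> z $ i))) ` {- 1, 1})"

text \<open>\<open>N(0, I\<^sub>p)\<close>, and the law of the noise \<open>(\<epsilon>\<^sub>i)\<close> for \<open>i < n\<close> with i.i.d. \<open>N(0, I\<^sub>p)\<close> entries.\<close>

definition std_gaussian :: "nat \<Rightarrow> (nat \<Rightarrow> real) measure" where
  "std_gaussian p = (\<Pi>\<^sub>M j\<in>{..<p}. density lborel std_normal_density)"

definition noise :: "nat \<Rightarrow> nat \<Rightarrow> (nat \<Rightarrow> nat \<Rightarrow> real) measure" where
  "noise p n = (\<Pi>\<^sub>M i\<in>{..<n}. std_gaussian p)"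

definition data_matrix :: "real vec \<Rightarrow> real vec \<Rightarrow> (nat \<Rightarrow> nat \<Rightarrow> real) \<Rightarrow> real mat" where
  "data_matrix \<theta> z \<epsilon> = Matrix.mat (dim_vec \<theta>) (dim_vec z) (\<lambda>(j, i). z $ i * \<theta> $ j + \<epsilon> i j)"

text \<open>
  ``\<open>P\<close> holds with probability at least \<open>q\<close>'', for \<open>P\<close> not known to be measurable: the inner
  probability of \<open>P\<close> is at least \<open>q\<close>.
\<close>

definition with_prob_at_least :: "'a measure \<Rightarrow> real \<Rightarrow> ('a \<Rightarrow> bool) \<Rightarrow> bool" where
  "with_prob_at_least M q P \<longleftrightarrow> (\<exists>E \<in> sets M. q \<le> measure M E \<and> (\<forall>\<omega>\<in>E. P \<omega>))"

end

theory Submission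
  imports Defs
begin

text \<open>
  Write \<open>T = \<parallel>\<theta>\<parallel>\<^sup>2\<close>, \<open>u\<^sub>0 = \<theta> / \<parallel>\<theta>\<parallel>\<close>, and \<open>M\<close> for the matrix of empirical second moments.  Since
  \<open>log p \<le> n\<close>, Chernoff bounds and a union bound give \<open>M = I + \<theta>\<theta>\<^sup>T + W\<close> with all entries of \<open>W\<close> at
  most \<open>lam / 2\<close>, outside an event of probability at most \<open>4 / p\<close>.  Everything about the estimator is
  deterministic on that event.  The definition of \<open>\<tau>\<close> implies that \<open>lam * s\<close> is at most \<open>h * T\<close> with
  \<open>h = 2 * C * \<tau>\<close> small, and three competitor arguments then determine the maximiser \<open>P\<close>:
  comparing with \<open>u\<^sub>0u\<^sub>0\<^sup>T\<close> shows \<open>u\<^sub>0\<^sup>TPu\<^sub>0 \<ge> 1 - 3h/2\<close>; erasing all entries outside the support \<open>S\<close>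
  of \<open>\<theta>\<close> and returning the lost trace as a multiple of \<open>u\<^sub>0u\<^sub>0\<^sup>T\<close> would increase the objective, so
  \<open>P\<close> lives on \<open>S \<times> S\<close>; and replacing \<open>P\<close> by the normalised rank-one matrix through \<open>P\<theta>\<close> would
  increase it too, so \<open>P = uu\<^sup>T\<close> for the leading eigenvector \<open>u\<close>.

  The signs of \<open>u \<bullet> X\<^sub>i\<close> cannot be analysed directly, because \<open>u\<close> depends on \<open>X\<^sub>i\<close> and a uniform
  bound over unit vectors supported on \<open>S\<close> is too lossy.  Instead \<open>u\<close> is compared with a
  near-maximiser \<open>v\<close>, among unit vectors on \<open>S\<close> aligned with \<open>\<theta>\<close>, of the objective without observation \<open>i\<close>.  The objective is concave, and
  the rank-one matrix through \<open>u + v\<close> beats the midpoint of \<open>uu\<^sup>T\<close> and \<open>vv\<^sup>T\<close> by an amount of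
  order \<open>T * \<parallel>u - v\<parallel>\<^sup>2\<close>; hence the objective at \<open>u\<close> exceeds the one at \<open>v\<close> by as much.  But leaving out
  one observation changes the objective difference only by
  \<open>((u \<bullet> X\<^sub>i)\<^sup>2 - (v \<bullet> X\<^sub>i)\<^sup>2) / n\<close>.  Together these two facts force \<open>u \<bullet> X\<^sub>i\<close> and
  \<open>v \<bullet> X\<^sub>i\<close> to have the same sign, unless \<open>X\<^sub>i\<close> restricted to \<open>S\<close> is huge or \<open>v \<bullet> X\<^sub>i\<close> is tiny
  (\<open>leave_one_out_sign\<close>).  So nothing is lost in passing to \<open>v\<close>.

  As \<open>v\<close> is independent of \<open>X\<^sub>i\<close> and \<open>v \<bullet> \<theta> \<ge> (1 - 3h/2) \<parallel>\<theta>\<parallel>\<close>, a Gaussian tail bound given the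
  other observations shows that observation \<open>i\<close> fails with probability at most
  \<open>2 exp (- T/2 (1 - 1000 C \<tau>))\<close> (\<open>loo_fails_prob\<close>, \<open>error_rate_bound\<close>).  Markov's
  inequality for the number of failures costs the factor \<open>exp (\<parallel>\<theta>\<parallel> / 2)\<close> in the rate, which is the
  term \<open>1 / \<parallel>\<theta>\<parallel>\<close> of the exponent, and the probability \<open>exp (- \<parallel>\<theta>\<parallel> / 2)\<close>.
\<close>

section \<open>Quadratic forms and positive semidefinite matrices\<close>

text \<open>
  Vectors and matrices are functions on \<open>nat\<close> of which only the entries below \<open>p\<close> count.  This
  makes restriction to a support, perturbation and dense families of vectors plain operations on
  functions, and lets the product topology serve as the topology of the parameter space.
\<close>

definition ip :: "nat \<Rightarrow> (nat \<Rightarrow> real) \<Rightarrow> (nat \<Rightarrow> real) \<Rightarrow> real" where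
  "ip p x y = (\<Sum>j<p. x j * y j)"

definition bil :: "nat \<Rightarrow> (nat \<Rightarrow> nat \<Rightarrow> real) \<Rightarrow> (nat \<Rightarrow> real) \<Rightarrow> (nat \<Rightarrow> real) \<Rightarrow> real" where
  "bil p A x y = (\<Sum>j<p. \<Sum>k<p. x j * A j k * y k)"

definition trc :: "nat \<Rightarrow> (nat \<Rightarrow> nat \<Rightarrow> real) \<Rightarrow> real" where
  "trc p A = (\<Sum>j<p. A j j)"

definition frob :: "nat \<Rightarrow> (nat \<Rightarrow> nat \<Rightarrow> real) \<Rightarrow> (nat \<Rightarrow> nat \<Rightarrow> real) \<Rightarrow> real" where
  "frob p A B = (\<Sum>j<p. \<Sum>k<p. A j k * B j k)"

definition l1 :: "nat \<Rightarrow> (nat \<Rightarrow> nat \<Rightarrow> real) \<Rightarrow> real" where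
  "l1 p A = (\<Sum>j<p. \<Sum>k<p. \<bar>A j k\<bar>)"

definition psd :: "nat \<Rightarrow> (nat \<Rightarrow> nat \<Rightarrow> real) \<Rightarrow> bool" where
  "psd p A \<longleftrightarrow> (\<forall>j<p. \<forall>k<p. A j k = A k j) \<and> (\<forall>x. 0 \<le> bil p A x x)"

definition supp_in :: "nat set \<Rightarrow> nat \<Rightarrow> (nat \<Rightarrow> nat \<Rightarrow> real) \<Rightarrow> bool" where
  "supp_in S p A \<longleftrightarrow> (\<forall>j<p. \<forall>k<p. A j k \<noteq> 0 \<longrightarrow> j \<in> S \<and> k \<in> S)"

definition rank_one :: "real \<Rightarrow> (nat \<Rightarrow> real) \<Rightarrow> nat \<Rightarrow> nat \<Rightarrow> real" where
  "rank_one c x = (\<lambda>j k. c * x j * x k)"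

definition basis_vec :: "nat \<Rightarrow> nat \<Rightarrow> real" where
  "basis_vec j = (\<lambda>i. of_bool (i = j))"

lemma ip_commute: "ip p x y = ip p y x"
  by (simp add: ip_def mult.commute)

lemma ip_add_left: "ip p (\<lambda>j. x j + y j) z = ip p x z + ip p y z"
  and ip_diff_left: "ip p (\<lambda>j. x j - y j) z = ip p x z - ip p y z"
  and ip_scale_left: "ip p (\<lambda>j. c * x j) z = c * ip p x z"
  by (simp_all add: ip_def algebra_simps sum.distrib sum_subtractf sum_distrib_left)

lemma ip_add_right: "ip p z (\<lambda>j. x j + y j) = ip p z x + ip p z y"
  and ip_diff_right: "ip p z (\<lambda>j. x j - y j) = ip p z x - ip p z y"
  and ip_scale_right: "ip p z (\<lambda>j. c * x j) = c * ip p z x"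
  by (simp_all add: ip_def algebra_simps sum.distrib sum_subtractf sum_distrib_left)

lemmas ip_lin = ip_add_left ip_diff_left ip_scale_left ip_add_right ip_diff_right ip_scale_right

lemma ip_nonneg: "0 \<le> ip p x x"
  by (simp add: ip_def sum_nonneg)

lemma ip_zero_iff: "ip p x x = 0 \<longleftrightarrow> (\<forall>j<p. x j = 0)"
  unfolding ip_def by (subst sum_nonneg_eq_0_iff) auto

lemma ip_Cauchy_Schwarz: "(ip p x y)\<^sup>2 \<le> ip p x x * ip p y y"
  using Cauchy_Schwarz_ineq_sum[of x y "{..<p}"] by (simp add: ip_def power2_eq_square)

lemma bil_add_left: "bil p A (\<lambda>j. x j + y j) z = bil p A x z + bil p A y z"
  and bil_diff_left: "bil p A (\<lambda>j. x j - y j) z = bil p A x z - bil p A y z"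
  and bil_scale_left: "bil p A (\<lambda>j. c * x j) z = c * bil p A x z"
  and bil_add_right: "bil p A z (\<lambda>j. x j + y j) = bil p A z x + bil p A z y"
  and bil_diff_right: "bil p A z (\<lambda>j. x j - y j) = bil p A z x - bil p A z y"
  and bil_scale_right: "bil p A z (\<lambda>j. c * x j) = c * bil p A z x"
  by (simp_all add: bil_def algebra_simps sum.distrib sum_subtractf sum_distrib_left)

lemmas bil_lin = bil_add_left bil_diff_left bil_scale_left bil_add_right bil_diff_right bil_scale_right

lemma bil_cong:
  "(\<And>j k. j < p \<Longrightarrow> k < p \<Longrightarrow> A j k = B j k) \<Longrightarrow> (\<And>j. j < p \<Longrightarrow> x j = y j) \<Longrightarrow> bil p A x x = bil p B y y"
  by (simp add: bil_def)

lemma bil_mat_add: "bil p (\<lambda>j k. A j k + B j k) x y = bil p A x y + bil p B x y"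
  and bil_mat_diff: "bil p (\<lambda>j k. A j k - B j k) x y = bil p A x y - bil p B x y"
  by (simp_all add: bil_def algebra_simps sum.distrib sum_subtractf)

lemma bil_rank_one: "bil p (rank_one c x) y z = c * ip p x y * ip p x z"
  by (simp add: bil_def rank_one_def ip_def sum_product sum_distrib_left algebra_simps)

lemma trc_add: "trc p (\<lambda>j k. A j k + B j k) = trc p A + trc p B"
  and trc_diff: "trc p (\<lambda>j k. A j k - B j k) = trc p A - trc p B"
  by (simp_all add: trc_def sum.distrib sum_subtractf)

lemma trc_rank_one: "trc p (rank_one c x) = c * ip p x x"
  by (simp add: trc_def rank_one_def ip_def sum_distrib_left mult.assoc)

lemma bil_commute:
  assumes "\<forall>j<p. \<forall>k<p. A j k = A k j"
  shows "bil p A x y = bil p A y x"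
proof -
  have "bil p A x y = (\<Sum>k<p. \<Sum>j<p. x j * A j k * y k)"
    unfolding bil_def by (rule sum.swap)
  also have "\<dots> = bil p A y x"
    unfolding bil_def
  proof (intro sum.cong refl)
    fix k j assume "k \<in> {..<p}" "j \<in> {..<p}"
    then have "A j k = A k j" using assms by blast
    then show "x j * A j k * y k = y k * A k j * x j" by (simp only: mult_ac)
  qed
  finally show ?thesis .
qed

lemma bil_basis_left:
  assumes "j < p"
  shows "bil p A (basis_vec j) x = (\<Sum>k<p. A j k * x k)"
proof -
  have "bil p A (basis_vec j) x = (\<Sum>i<p. if i = j then \<Sum>k<p. A i k * x k else 0)"
    unfolding bil_def basis_vec_def by (intro sum.cong) auto
  then show ?thesis using assms by simp
qed

lemma bil_basis:
  assumes "j < p" "k < p"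
  shows "bil p A (basis_vec j) (basis_vec k) = A j k"
proof -
  have "(\<Sum>i<p. A j i * basis_vec k i) = (\<Sum>i<p. if i = k then A j i else 0)"
    unfolding basis_vec_def by (intro sum.cong) auto
  then show ?thesis using assms by (simp add: bil_basis_left)
qed

lemma bil_eq_ip: "bil p A x y = ip p x (\<lambda>j. \<Sum>k<p. A j k * y k)"
  by (simp add: bil_def ip_def sum_distrib_left mult.assoc)

lemma psd_sym: "psd p A \<Longrightarrow> j < p \<Longrightarrow> k < p \<Longrightarrow> A j k = A k j"
  by (simp add: psd_def)

lemma psd_nonneg: "psd p A \<Longrightarrow> 0 \<le> bil p A x x"
  by (simp add: psd_def)

lemma psd_add: "psd p A \<Longrightarrow> psd p B \<Longrightarrow> psd p (\<lambda>j k. A j k + B j k)"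
  by (simp add: psd_def bil_mat_add)

lemma psd_rank_one: "0 \<le> c \<Longrightarrow> psd p (rank_one c x)"
  by (simp add: psd_def bil_rank_one mult.assoc) (simp add: rank_one_def)

lemma psd_diag_nonneg: "psd p A \<Longrightarrow> j < p \<Longrightarrow> 0 \<le> A j j"
  using psd_nonneg[of p A "basis_vec j"] bil_basis[of j p j A] by simp

lemma psd_trc_nonneg: "psd p A \<Longrightarrow> 0 \<le> trc p A"
  unfolding trc_def by (intro sum_nonneg) (auto intro: psd_diag_nonneg)

lemma psd_entry_le:
  assumes "psd p A" "j < p" "k < p"
  shows "2 * \<bar>A j k\<bar> \<le> A j j + A k k"
proof -
  have sym: "A k j = A j k" using assms psd_sym by blast
  have "0 \<le> bil p A (\<lambda>i. basis_vec j i + basis_vec k i) (\<lambda>i. basis_vec j i + basis_vec k i)"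
       "0 \<le> bil p A (\<lambda>i. basis_vec j i - basis_vec k i) (\<lambda>i. basis_vec j i - basis_vec k i)"
    using assms(1) by (rule psd_nonneg)+
  then show ?thesis
    using assms(2,3) by (simp add: bil_lin bil_basis sym)
qed

lemma psd_trc_zero:
  assumes "psd p A" "trc p A = 0" "j < p" "k < p"
  shows "A j k = 0"
proof -
  have "\<forall>i\<in>{..<p}. A i i = 0"
    using assms(1,2) unfolding trc_def
    by (subst (asm) sum_nonneg_eq_0_iff) (auto intro: psd_diag_nonneg)
  then show ?thesis using psd_entry_le[OF assms(1,3,4)] assms(3,4) by simp
qed

text \<open>
  For a unit vector \<open>x\<close> the difference of the two sides is the trace of the compression of \<open>A\<close> to
  the orthogonal complement of \<open>x\<close>.  In particular the constraint \<open>P \<preceq> I\<close> of the Fantope follows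
  from the other constraints.
\<close>

lemma psd_le_trc:
  assumes "psd p A"
  shows "bil p A x x \<le> trc p A * ip p x x"
proof -
  define N where "N = ip p x x"
  have N0: "0 \<le> N" by (simp add: N_def ip_nonneg)
  have row: "(\<Sum>j<p. x j * bil p A (basis_vec j) x) = bil p A x x"
    unfolding bil_def[of p A x x]
    by (intro sum.cong refl) (simp add: bil_basis_left sum_distrib_left mult.assoc)
  have row': "bil p A x (basis_vec j) = bil p A (basis_vec j) x" for j
    using assms by (intro bil_commute) (auto simp: psd_def)
  \<comment> \<open>the trace of the compression to the complement of \<open>x\<close>, scaled by \<open>N\<^sup>2\<close>\<close>
  have "0 \<le> (\<Sum>j<p. bil p A (\<lambda>i. N * basis_vec j i - x j * x i) (\<lambda>i. N * basis_vec j i - x j * x i))"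
    using assms by (intro sum_nonneg psd_nonneg)
  also have "\<dots> = (\<Sum>j<p. N\<^sup>2 * A j j - 2 * N * (x j * bil p A (basis_vec j) x) + (x j * x j) * bil p A x x)"
    by (intro sum.cong refl) (simp add: bil_lin row' bil_basis algebra_simps power2_eq_square)
  also have "\<dots> = N\<^sup>2 * trc p A - 2 * N * bil p A x x + N * bil p A x x"
    by (simp add: sum.distrib sum_subtractf flip: sum_distrib_left sum_distrib_right row)
       (simp add: N_def ip_def trc_def row sum_distrib_right)
  also have "\<dots> = N * (N * trc p A - bil p A x x)"
    by (simp add: algebra_simps power2_eq_square)
  finally have *: "0 \<le> N * (N * trc p A - bil p A x x)" .
  show ?thesis
  proof (cases "N = 0")
    case True
    then have "\<forall>j<p. x j = 0" by (simp add: N_def ip_zero_iff)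
    then have "bil p A x x = 0" by (simp add: bil_def)
    then show ?thesis using True N_def by simp
  next
    case False
    then show ?thesis using * N0 by (simp add: zero_le_mult_iff N_def mult.commute)
  qed
qed

text \<open>
  An entry of a positive semidefinite matrix is at most the mean of the two diagonal entries in its
  row and column.  This is how sparsity enters: on such matrices the penalty costs at most
  \<open>lam * card S\<close> per unit of trace.
\<close>

lemma l1_le_card_trc:
  assumes "psd p A" "supp_in S p A" "S \<subseteq> {..<p}"
  shows "l1 p A \<le> card S * trc p A"
proof -
  have fin: "finite S" using assms(3) finite_subset by blast
  have z: "A j k = 0" if "j < p" "k < p" "j \<notin> S \<or> k \<notin> S" for j k
    using assms(2) that unfolding supp_in_def by blast
  have "l1 p A = (\<Sum>j\<in>S. \<Sum>k\<in>S. \<bar>A j k\<bar>)"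
  proof -
    have "l1 p A = (\<Sum>j<p. \<Sum>k\<in>S. \<bar>A j k\<bar>)"
      unfolding l1_def using assms(3) z by (intro sum.cong sum.mono_neutral_right) auto
    also have "\<dots> = (\<Sum>j\<in>S. \<Sum>k\<in>S. \<bar>A j k\<bar>)"
      using assms(3) z by (intro sum.mono_neutral_right sum.neutral ballI) (auto intro!: sum.neutral)
    finally show ?thesis .
  qed
  also have "\<dots> \<le> (\<Sum>j\<in>S. \<Sum>k\<in>S. (A j j + A k k) / 2)"
  proof (intro sum_mono)
    fix j k assume "j \<in> S" "k \<in> S"
    then have "2 * \<bar>A j k\<bar> \<le> A j j + A k k" using assms by (intro psd_entry_le) auto
    then show "\<bar>A j k\<bar> \<le> (A j j + A k k) / 2" by simp
  qed
  also have "\<dots> = card S * (\<Sum>j\<in>S. A j j)"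
    by (simp add: sum.distrib add_divide_distrib flip: sum_divide_distrib sum_distrib_left)
  also have "(\<Sum>j\<in>S. A j j) = trc p A"
    unfolding trc_def using assms(3) z by (intro sum.mono_neutral_left) auto
  finally show ?thesis .
qed

lemma frob_le_l1:
  assumes "\<And>j k. j < p \<Longrightarrow> k < p \<Longrightarrow> \<bar>W j k\<bar> \<le> w"
  shows "\<bar>frob p W A\<bar> \<le> w * l1 p A"
proof -
  have "\<bar>frob p W A\<bar> \<le> (\<Sum>j<p. \<Sum>k<p. \<bar>W j k * A j k\<bar>)"
    unfolding frob_def by (intro order.trans[OF sum_abs] sum_mono order.trans[OF sum_abs]) auto
  also have "\<dots> \<le> w * l1 p A"
    unfolding l1_def sum_distrib_left
    by (intro sum_mono) (auto simp: abs_mult intro!: mult_right_mono assms)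
  finally show ?thesis .
qed

lemma supp_in_rank_one: "\<forall>j. j \<notin> S \<longrightarrow> x j = 0 \<Longrightarrow> supp_in S p (rank_one c x)"
  by (auto simp: supp_in_def rank_one_def)

section \<open>The penalised maximiser under a spiked second-moment matrix\<close>

definition penobj :: "nat \<Rightarrow> (nat \<Rightarrow> nat \<Rightarrow> real) \<Rightarrow> real \<Rightarrow> (nat \<Rightarrow> nat \<Rightarrow> real) \<Rightarrow> real" where
  "penobj p M lam A = frob p M A - lam * l1 p A"

definition pen_max :: "nat \<Rightarrow> (nat \<Rightarrow> nat \<Rightarrow> real) \<Rightarrow> real \<Rightarrow> (nat \<Rightarrow> nat \<Rightarrow> real) \<Rightarrow> bool" where
  "pen_max p M lam P \<longleftrightarrow> psd p P \<and> trc p P = 1 \<and>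
     (\<forall>Q. psd p Q \<and> trc p Q = 1 \<longrightarrow> penobj p M lam Q \<le> penobj p M lam P)"

text \<open>
  \<open>M\<close> agrees with \<open>I + \<theta>\<theta>\<^sup>T\<close> up to entrywise errors of half the penalty level.  The penalty thus
  dominates the noise, while \<open>lamS\<close> makes it small against the signal on matrices supported on \<open>S\<close>.
  The bound on \<open>h\<close> is what \<open>1 - 9h \<ge> 1/2\<close> requires, the gain per unit of weight in \<open>rank_one_stability\<close>.
\<close>

locale spiked =
  fixes p :: nat and S :: "nat set" and \<theta> :: "nat \<Rightarrow> real"
    and M :: "nat \<Rightarrow> nat \<Rightarrow> real" and lam h T :: real
  assumes S: "S \<subseteq> {..<p}"
    and supp: "\<And>j. j \<notin> S \<Longrightarrow> \<theta> j = 0"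
    and dev: "\<And>j k. j < p \<Longrightarrow> k < p \<Longrightarrow> \<bar>M j k - of_bool (j = k) - \<theta> j * \<theta> k\<bar> \<le> lam / 2"
    and lam: "0 < lam"
    and T_def: "T = ip p \<theta> \<theta>"
    and T_pos: "0 < T"
    and lamS: "lam * card S \<le> h * T"
    and h: "h \<le> 1 / 18"
begin

lemma h_nonneg: "0 \<le> h"
proof -
  have "0 \<le> lam * card S" using lam by simp
  then have "0 \<le> h * T" using lamS by linarith
  then show ?thesis using T_pos by (simp add: zero_le_mult_iff)
qed

lemma frob_M:
  shows frob_M_upper: "frob p M A \<le> trc p A + bil p A \<theta> \<theta> + lam / 2 * l1 p A"
    and frob_M_lower: "trc p A + bil p A \<theta> \<theta> - lam / 2 * l1 p A \<le> frob p M A"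
proof -
  have "trc p A = (\<Sum>j<p. \<Sum>k<p. of_bool (j = k) * A j k)"
    unfolding trc_def by (intro sum.cong refl)
      (simp add: of_bool_def if_distrib if_distribR cong: if_cong)
  then have "frob p M A - trc p A - bil p A \<theta> \<theta> =
      frob p (\<lambda>j k. M j k - of_bool (j = k) - \<theta> j * \<theta> k) A"
    by (simp add: frob_def bil_def algebra_simps sum.distrib sum_subtractf)
  moreover have "\<bar>frob p (\<lambda>j k. M j k - of_bool (j = k) - \<theta> j * \<theta> k) A\<bar> \<le> lam / 2 * l1 p A"
    using dev by (rule frob_le_l1)
  ultimately show "frob p M A \<le> trc p A + bil p A \<theta> \<theta> + lam / 2 * l1 p A"
    and "trc p A + bil p A \<theta> \<theta> - lam / 2 * l1 p A \<le> frob p M A"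
    by linarith+
qed

text \<open>
  All comparisons below exchange a piece \<open>D\<close> of a candidate for a piece \<open>B\<close>.  Per unit of trace on
  \<open>S\<close>, the noise contributes at most \<open>h T / 2\<close> and the penalty at most \<open>h T\<close>.
\<close>

lemma penobj_perturb:
  assumes "psd p B" "supp_in S p B" "psd p D" "supp_in S p D"
  shows "penobj p M lam (\<lambda>j k. A j k + B j k - D j k) \<ge> penobj p M lam A
    + (trc p B + bil p B \<theta> \<theta>) - (trc p D + bil p D \<theta> \<theta>) - 3/2 * h * T * (trc p B + trc p D)"
proof -
  have lin: "frob p M (\<lambda>j k. A j k + B j k - D j k) = frob p M A + frob p M B - frob p M D"
    by (simp add: frob_def algebra_simps sum.distrib sum_subtractf)
  have tri: "l1 p (\<lambda>j k. A j k + B j k - D j k) \<le> l1 p A + l1 p B + l1 p D"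
    unfolding l1_def sum.distrib[symmetric] by (intro sum_mono) linarith
  have key: "lam * l1 p E \<le> h * T * trc p E" if "psd p E" "supp_in S p E" for E
  proof -
    have "lam * l1 p E \<le> lam * (card S * trc p E)"
      using l1_le_card_trc[OF that S] lam by (intro mult_left_mono) auto
    also have "\<dots> = (lam * card S) * trc p E" by simp
    also have "\<dots> \<le> h * T * trc p E"
      using lamS psd_trc_nonneg[OF that(1)] by (rule mult_right_mono)
    finally show ?thesis .
  qed
  have "lam * l1 p (\<lambda>j k. A j k + B j k - D j k) \<le> lam * (l1 p A + l1 p B + l1 p D)"
    using tri lam by (intro mult_left_mono) auto
  also have "\<dots> = lam * l1 p A + lam * l1 p B + lam * l1 p D" by (simp add: algebra_simps)
  finally have "lam * l1 p (\<lambda>j k. A j k + B j k - D j k) \<le> lam * l1 p A + lam * l1 p B + lam * l1 p D" .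
  moreover have "3/2 * h * T * (trc p B + trc p D) = 3/2 * (h * T * trc p B) + 3/2 * (h * T * trc p D)"
    by (simp add: algebra_simps)
  moreover have "lam / 2 * l1 p B = 1/2 * (lam * l1 p B)" "lam / 2 * l1 p D = 1/2 * (lam * l1 p D)"
    by simp_all
  ultimately show ?thesis
    using lin key[OF assms(1,2)] key[OF assms(3,4)] frob_M_lower[of B] frob_M_upper[of D]
    unfolding penobj_def by linarith
qed

lemma feasible_signal: "psd p (rank_one (1 / T) \<theta>)" "trc p (rank_one (1 / T) \<theta>) = 1"
  using T_pos by (auto intro!: psd_rank_one simp: trc_rank_one T_def)

lemma supp_signal: "supp_in S p (rank_one c \<theta>)"
  using supp by (auto intro: supp_in_rank_one)

text \<open>
  The signal \<open>\<theta>\<theta>\<^sup>T / T\<close> loses at most \<open>3/2 * h * T\<close> to noise and penalty, while for the maximiser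
  the penalty cancels whatever the noise may add.
\<close>

lemma pen_max_alignment:
  assumes "pen_max p M lam P"
  shows "T * (1 - 3/2 * h) \<le> bil p P \<theta> \<theta>"
proof -
  have z: "psd p (\<lambda>j k. 0)" "supp_in S p (\<lambda>j k. 0)" by (simp_all add: psd_def bil_def supp_in_def)
  have "penobj p M lam (rank_one (1 / T) \<theta>) \<ge> 1 + T - 3/2 * h * T"
    using penobj_perturb[OF feasible_signal(1) supp_signal z, of "\<lambda>j k. 0"] feasible_signal(2) T_pos
    by (simp add: penobj_def frob_def l1_def trc_def[of _ "\<lambda>j k. 0"] bil_def[of _ "\<lambda>j k. 0"] bil_rank_one
        flip: T_def)
  moreover have "penobj p M lam (rank_one (1 / T) \<theta>) \<le> penobj p M lam P"
    using assms feasible_signal unfolding pen_max_def by blast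
  moreover have "penobj p M lam P \<le> 1 + bil p P \<theta> \<theta>"
  proof -
    have "0 \<le> lam * l1 p P" using lam by (simp add: l1_def sum_nonneg)
    then show ?thesis using frob_M_upper[of P] assms unfolding penobj_def pen_max_def by linarith
  qed
  ultimately show ?thesis by (simp add: algebra_simps)
qed

text \<open>
  Off \<open>S \<times> S\<close> there is no signal, so each entry there costs more in penalty than it can gain from
  the noise.  The trace that is lost by erasing these entries is worth more as a multiple of \<open>\<theta>\<theta>\<^sup>T\<close>.
\<close>

lemma pen_max_supported:
  assumes P: "pen_max p M lam P"
  shows "supp_in S p P"
proof -
  define PS where "PS = (\<lambda>j k. if j \<in> S \<and> k \<in> S then P j k else 0)"
  define Off where "Off = (\<lambda>j k. if j \<in> S \<and> k \<in> S then 0 else P j k)"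
  have split: "P j k = PS j k + Off j k" for j k by (simp add: PS_def Off_def)
  define m where "m = trc p Off"
  have psdP: "psd p P" and trP: "trc p P = 1" using P by (auto simp: pen_max_def)
  have psdPS: "psd p PS"
  proof -
    have "bil p PS x x = bil p P (\<lambda>j. if j \<in> S then x j else 0) (\<lambda>j. if j \<in> S then x j else 0)" for x
      by (auto simp: bil_def PS_def intro!: sum.cong)
    then show ?thesis using psdP by (auto simp: psd_def PS_def)
  qed
  have m0: "0 \<le> m"
    unfolding m_def trc_def Off_def using psd_diag_nonneg[OF psdP] by (intro sum_nonneg) auto
  have trPS: "trc p PS = 1 - m"
    using trP trc_add[of p PS Off] by (simp add: m_def flip: split)
  have l1split: "l1 p P = l1 p PS + l1 p Off"
    unfolding l1_def sum.distrib[symmetric] by (intro sum.cong refl) (auto simp: PS_def Off_def)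
  have fsplit: "frob p M P = frob p M PS + frob p M Off"
    unfolding frob_def sum.distrib[symmetric]
    by (intro sum.cong refl) (auto simp: PS_def Off_def)
  have "bil p Off \<theta> \<theta> = 0"
    unfolding bil_def using supp by (intro sum.neutral ballI) (auto simp: Off_def)
  then have foff: "frob p M Off \<le> m + lam / 2 * l1 p Off"
    using frob_M_upper[of Off] by (simp add: m_def)
  have z: "psd p (\<lambda>j k. 0)" "supp_in S p (\<lambda>j k. 0)" by (simp_all add: psd_def bil_def supp_in_def)
  define Q where "Q = (\<lambda>j k. PS j k + rank_one (m / T) \<theta> j k)"
  have "0 \<le> m / T" using m0 T_pos by simp
  note psdm = psd_rank_one[OF this, of p \<theta>]
  have feas: "psd p Q" "trc p Q = 1"
    using psd_add[OF psdPS psdm] trPS T_pos T_def unfolding Q_def by (auto simp: trc_add trc_rank_one)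
  have "penobj p M lam Q \<ge> penobj p M lam PS + (m + m * T) - 3/2 * h * T * m"
    using penobj_perturb[OF psdm supp_signal z, of PS] T_pos
    by (simp add: Q_def trc_def[of _ "\<lambda>j k. 0"] bil_def[of _ "\<lambda>j k. 0"] trc_rank_one bil_rank_one
        flip: T_def)
  moreover have "penobj p M lam PS \<ge> penobj p M lam P - m + lam / 2 * l1 p Off"
    using foff l1split fsplit by (simp add: penobj_def algebra_simps)
  moreover have "penobj p M lam Q \<le> penobj p M lam P"
    using P feas unfolding pen_max_def by blast
  ultimately have "m * T - 3/2 * h * T * m + lam / 2 * l1 p Off \<le> 0"
    by linarith
  moreover have "0 \<le> m * T * (1 - 3/2 * h)"
    using m0 T_pos h by simp
  ultimately have "lam / 2 * l1 p Off \<le> 0" by (simp add: algebra_simps)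
  then have "l1 p Off \<le> 0" using lam by (simp add: mult_le_0_iff)
  moreover have "l1 p Off = 0 \<longleftrightarrow> (\<forall>j<p. \<forall>k<p. Off j k = 0)"
    unfolding l1_def by (subst sum_nonneg_eq_0_iff, simp, simp add: sum_nonneg, subst sum_nonneg_eq_0_iff) auto
  moreover have "0 \<le> l1 p Off" by (simp add: l1_def sum_nonneg)
  ultimately have "\<forall>j<p. \<forall>k<p. Off j k = 0" by (meson order.antisym)
  then show ?thesis by (auto simp: supp_in_def Off_def split: if_splits)
qed

text \<open>
  With \<open>y = P\<theta>\<close> and \<open>q = \<theta>\<^sup>TP\<theta>\<close>, the Schur complement \<open>R = P - yy\<^sup>T / q\<close> is positive semidefinite and
  annihilates \<open>\<theta>\<close>.  Moving its trace onto \<open>yy\<^sup>T\<close> gains signal and costs only terms of order \<open>h\<close>, so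
  \<open>R = 0\<close>.  This avoids any spectral decomposition of \<open>P\<close>: the eigenvector \<open>y\<close> of eigenvalue \<open>1\<close> is
  explicit, and a leading eigenvector must then be proportional to it.
\<close>

lemma pen_max_rank_one:
  assumes P: "pen_max p M lam P" and u1: "ip p u u = 1"
    and eig: "\<And>j. j < p \<Longrightarrow> (\<Sum>k<p. P j k * u k) = k * u j"
    and lead: "\<And>k' v. (\<And>j. j < p \<Longrightarrow> (\<Sum>k<p. P j k * v k) = k' * v j) \<Longrightarrow> ip p v v \<noteq> 0 \<Longrightarrow> k' \<le> k"
    and j: "j < p" and l: "l < p"
  shows "P j l = u j * u l"
proof -
  have psdP: "psd p P" and trP: "trc p P = 1" using P by (auto simp: pen_max_def)
  define y where "y = (\<lambda>j. \<Sum>k<p. P j k * \<theta> k)"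
  define q where "q = bil p P \<theta> \<theta>"
  define N where "N = ip p y y"
  have q_ge: "T * (1 - 3/2 * h) \<le> q" using pen_max_alignment[OF P] q_def by simp
  have qpos: "0 < q"
  proof -
    have "0 < T * (1 - 3/2 * h)" using T_pos h by simp
    then show ?thesis using q_ge by linarith
  qed
  have xy: "bil p P x \<theta> = ip p x y" for x by (simp add: bil_eq_ip y_def)
  have yx: "bil p P \<theta> x = ip p x y" for x
    using bil_commute[of p P \<theta> x] psd_sym[OF psdP] xy by auto
  have y\<theta>: "ip p y \<theta> = q" using xy[of \<theta>] by (simp add: q_def ip_commute)
  have Npos: "0 < N"
  proof -
    have "N \<noteq> 0"
    proof
      assume "N = 0"
      then have "\<forall>j<p. y j = 0" by (simp add: N_def ip_zero_iff)
      then have "ip p y \<theta> = 0" by (simp add: ip_def)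
      then show False using y\<theta> qpos by simp
    qed
    then show ?thesis using ip_nonneg[of p y] N_def by linarith
  qed
  define R where "R = (\<lambda>j k. P j k - rank_one (1 / q) y j k)"
  have psdR: "psd p R"
  proof -
    have "0 \<le> bil p R x x" for x
    proof -
      define c where "c = ip p x y / q"
      \<comment> \<open>the choice of \<open>c\<close> minimises the form over \<open>x + \<real>\<theta>\<close>\<close>
      have "0 \<le> bil p P (\<lambda>j. x j - c * \<theta> j) (\<lambda>j. x j - c * \<theta> j)"
        using psdP by (rule psd_nonneg)
      also have "\<dots> = bil p P x x - 2 * c * ip p x y + c\<^sup>2 * q"
        by (simp only: bil_lin xy yx) (simp add: power2_eq_square y\<theta> ip_commute[of p \<theta>] algebra_simps)
      also have "\<dots> = bil p P x x - (ip p x y)\<^sup>2 / q"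
        using qpos by (simp add: c_def power2_eq_square field_simps)
      also have "\<dots> = bil p R x x"
        by (simp add: R_def bil_mat_diff bil_rank_one power2_eq_square ip_commute)
      finally show ?thesis .
    qed
    then show ?thesis using psd_sym[OF psdP] by (auto simp: psd_def R_def rank_one_def)
  qed
  define m where "m = trc p R"
  have m0: "0 \<le> m" using psd_trc_nonneg[OF psdR] m_def by simp
  have m_eq: "m = 1 - N / q" by (simp add: m_def R_def trc_diff trc_rank_one trP N_def)
  have Nq: "N \<le> q" using m0 m_eq qpos by (simp add: divide_le_eq)
  have suppP: "supp_in S p P" by (rule pen_max_supported[OF P])
  have ysupp: "y j = 0" if "j < p" "j \<notin> S" for j
    using suppP that unfolding y_def supp_in_def by (intro sum.neutral) auto
  have srk: "supp_in S p (rank_one c y)" for c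
    using ysupp by (auto simp: supp_in_def rank_one_def)
  have suppR: "supp_in S p R"
    using suppP srk[of "1/q"] unfolding supp_in_def R_def by fastforce
  have psdm: "psd p (rank_one (m / N) y)" using m0 Npos by (intro psd_rank_one) simp
  define Q where "Q = rank_one (1 / N) y"
  have feas: "psd p Q" "trc p Q = 1"
    using Npos by (auto simp: Q_def trc_rank_one N_def intro!: psd_rank_one)
  have Qeq: "Q = (\<lambda>j k. P j k + rank_one (m / N) y j k - R j k)"
  proof (intro ext)
    fix j k
    have "m / N + 1 / q = 1 / N" using Npos qpos by (simp add: m_eq field_simps)
    then have "(m / N + 1 / q) * (y j * y k) = 1 / N * (y j * y k)" by simp
    then show "Q j k = P j k + rank_one (m / N) y j k - R j k"
      by (simp add: Q_def R_def rank_one_def algebra_simps)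
  qed
  have bR: "bil p R \<theta> \<theta> = 0"
    using qpos by (simp add: R_def bil_mat_diff bil_rank_one y\<theta> flip: q_def)
  have tB: "trc p (rank_one (m / N) y) = m" using Npos by (simp add: trc_rank_one N_def)
  have bB: "bil p (rank_one (m / N) y) \<theta> \<theta> \<ge> m * q"
  proof -
    have "q * 1 \<le> q * (q / N)" using qpos Nq Npos by (intro mult_left_mono) auto
    then have "m * q \<le> m * (q * (q / N))" using m0 by (intro mult_left_mono) auto
    then show ?thesis by (simp add: bil_rank_one y\<theta>)
  qed
  have "penobj p M lam Q \<ge> penobj p M lam P + (m + m * q) - m - 3/2 * h * T * (m + m)"
    using penobj_perturb[OF psdm srk psdR suppR, of P] bR tB bB
    by (simp add: Qeq flip: m_def)
  moreover have "penobj p M lam Q \<le> penobj p M lam P"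
    using P feas unfolding pen_max_def by blast
  moreover have "3/2 * h * T * (m + m) = 3 * h * T * m" by simp
  ultimately have "m * q \<le> 3 * h * T * m" by linarith
  moreover have "m * (T * (1 - 3/2 * h)) \<le> m * q" using q_ge m0 by (rule mult_left_mono)
  ultimately have "m * (T * (1 - 9/2 * h)) \<le> 0" by (simp add: algebra_simps)
  moreover have "0 < T * (1 - 9/2 * h)" using T_pos h by simp
  ultimately have "m = 0" using m0 mult_le_0_iff[of m "T * (1 - 9/2 * h)"] by linarith
  then have Nq': "N = q" using m_eq qpos by simp
  have P_eq: "P j k = y j * y k / q" if "j < p" "k < p" for j k
    using psd_trc_zero[OF psdR, of j k] \<open>m = 0\<close> that by (simp add: m_def R_def rank_one_def)
  have Pv: "(\<Sum>k<p. P j k * v k) = ip p y v / q * y j" if "j < p" for j v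
    using that by (simp add: P_eq ip_def sum_distrib_left sum_divide_distrib mult_ac)
  have "1 \<le> k"
  proof (rule lead)
    show "(\<Sum>k<p. P j k * y k) = 1 * y j" if "j < p" for j
      using Pv[OF that, of y] qpos Nq' by (simp add: N_def)
    show "ip p y y \<noteq> 0" using Npos N_def by simp
  qed
  define \<beta> where "\<beta> = ip p y u / (q * k)"
  have u_eq: "u j = \<beta> * y j" if "j < p" for j
    using eig[OF that] Pv[OF that, of u] \<open>1 \<le> k\<close> qpos by (simp add: \<beta>_def field_simps)
  have "1 = ip p (\<lambda>j. \<beta> * y j) (\<lambda>j. \<beta> * y j)"
    using u_eq by (simp add: ip_def flip: u1)
  also have "\<dots> = \<beta>\<^sup>2 * q" using Nq' by (simp add: ip_lin N_def power2_eq_square)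
  finally have "\<beta>\<^sup>2 = 1 / q" using qpos by (simp add: field_simps)
  moreover have "u j * u l = \<beta>\<^sup>2 * (y j * y l)" using j l by (simp add: u_eq power2_eq_square)
  ultimately show ?thesis using j l by (simp add: P_eq)
qed

lemma penobj_cong: "(\<And>j k. j < p \<Longrightarrow> k < p \<Longrightarrow> A j k = B j k) \<Longrightarrow> penobj p N l A = penobj p N l B"
  by (simp add: penobj_def frob_def l1_def)

text \<open>
  The penalty is not strictly convex; the quadratic gain comes from the curvature of the set of
  rank-one projections.  The midpoint of \<open>uu\<^sup>T\<close> and \<open>vv\<^sup>T\<close> has weight \<open>\<parallel>u - v\<parallel>\<^sup>2 / 4\<close> on the direction
  \<open>u - v\<close>.  Since \<open>u + v\<close> is nearly parallel to \<open>\<theta>\<close>, the direction \<open>u - v\<close> carries almost no signal, by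
  Bessel's inequality, and shifting that weight to \<open>u + v\<close> gains almost \<open>T\<close> per unit.
\<close>

lemma rank_one_stability:
  assumes max: "pen_max p M lam (rank_one 1 u)"
    and u1: "ip p u u = 1" and v1: "ip p v v = 1"
    and suppu: "\<forall>j. j \<notin> S \<longrightarrow> u j = 0" and suppv: "\<forall>j. j \<notin> S \<longrightarrow> v j = 0"
    and u\<theta>: "(1 - 3/2 * h) * sqrt T \<le> ip p u \<theta>" and v\<theta>: "(1 - 3/2 * h) * sqrt T \<le> ip p v \<theta>"
  shows "T / 4 * ip p (\<lambda>j. u j - v j) (\<lambda>j. u j - v j)
           \<le> penobj p M lam (rank_one 1 u) - penobj p M lam (rank_one 1 v)"
proof -
  define c where "c = ip p u v"
  define w where "w = (\<lambda>j. u j + v j)"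
  define d where "d = (\<lambda>j. u j - v j)"
  define m where "m = (1 - c) / 2"
  define N where "N = 2 + 2 * c"
  define a where "a = ip p w \<theta>"
  define b where "b = ip p d \<theta>"
  define \<alpha> where "\<alpha> = 1 - 3/2 * h"
  have ww: "ip p w w = N" and dd: "ip p d d = 4 * m" and wd: "ip p w d = 0"
    using u1 v1 ip_commute[of p v u] unfolding w_def d_def m_def N_def c_def ip_lin by simp_all
  have m0: "0 \<le> m" using ip_nonneg[of p d] dd by simp
  then have N4: "N \<le> 4" by (simp add: m_def N_def)
  have \<alpha>0: "0 < \<alpha>" using h by (simp add: \<alpha>_def)
  have "a = ip p u \<theta> + ip p v \<theta>" by (simp add: a_def w_def ip_lin)
  then have a_ge: "2 * \<alpha> * sqrt T \<le> a"
    using u\<theta> v\<theta> unfolding \<alpha>_def[symmetric] by linarith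
  moreover have "0 < 2 * \<alpha> * sqrt T" using \<alpha>0 T_pos by simp
  ultimately have a0: "0 < a" by linarith
  have Npos: "0 < N"
  proof -
    have "N \<noteq> 0"
    proof
      assume "N = 0"
      then have "\<forall>j<p. w j = 0" using ww by (simp add: ip_zero_iff)
      then have "a = 0" by (simp add: a_def ip_def)
      then show False using a0 by simp
    qed
    then show ?thesis using ip_nonneg[of p w] ww by linarith
  qed
  have aN: "\<alpha>\<^sup>2 * T \<le> a\<^sup>2 / N"
  proof -
    have "(2 * \<alpha> * sqrt T)\<^sup>2 \<le> a\<^sup>2"
      using a_ge \<alpha>0 T_pos by (intro power_mono) auto
    then have "4 * (\<alpha>\<^sup>2 * T) \<le> a\<^sup>2" using T_pos by (simp add: power_mult_distrib)
    moreover have "N * (\<alpha>\<^sup>2 * T) \<le> 4 * (\<alpha>\<^sup>2 * T)" using N4 T_pos by (intro mult_right_mono) auto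
    ultimately show ?thesis using Npos by (simp add: field_simps)
  qed
  have bessel: "b\<^sup>2 / 4 \<le> m * (T - a\<^sup>2 / N)"
  proof -
    define r where "r = (\<lambda>j. \<theta> j - (a / N) * w j)"
    have "ip p d r = b"
      unfolding r_def ip_lin using wd by (simp add: b_def ip_commute[of p d w])
    moreover have "ip p r r = T - a\<^sup>2 / N"
      unfolding r_def ip_lin using Npos
      by (simp add: ww T_def ip_commute[of p \<theta> w] power2_eq_square flip: a_def)
    ultimately have "b\<^sup>2 \<le> 4 * m * (T - a\<^sup>2 / N)" using ip_Cauchy_Schwarz[of p d r] dd by simp
    also have "\<dots> = 4 * (m * (T - a\<^sup>2 / N))" by (simp only: mult.assoc)
    finally show ?thesis by linarith
  qed
  define mid where "mid = (\<lambda>j k. rank_one (1/2) u j k + rank_one (1/2) v j k)"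
  have feas: "psd p (rank_one (1 / N) w)" "trc p (rank_one (1 / N) w) = 1"
    using Npos ww by (auto intro!: psd_rank_one simp: trc_rank_one)
  have eq: "rank_one (1 / N) w = (\<lambda>j k. mid j k + rank_one (m / N) w j k - rank_one (1/4) d j k)"
  proof (intro ext)
    fix j k
    have "1 / N = 1/4 + m / N" using Npos by (simp add: m_def N_def field_simps)
    then have "rank_one (1 / N) w j k = (1/4 + m / N) * (w j * w k)" by (simp add: rank_one_def)
    also have "\<dots> = w j * w k / 4 + m / N * (w j * w k)" by (simp add: distrib_right)
    also have "w j * w k / 4 = mid j k - d j * d k / 4"
      by (simp add: mid_def rank_one_def w_def d_def field_simps)
    finally show "rank_one (1 / N) w j k = mid j k + rank_one (m / N) w j k - rank_one (1/4) d j k"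
      by (simp add: rank_one_def mult.assoc)
  qed
  have psds: "psd p (rank_one (m / N) w)" "psd p (rank_one (1/4) d)"
    using m0 Npos by (auto intro!: psd_rank_one)
  have supps: "supp_in S p (rank_one (m / N) w)" "supp_in S p (rank_one (1/4) d)"
    using suppu suppv by (auto intro!: supp_in_rank_one simp: w_def d_def)
  have "penobj p M lam (rank_one (1 / N) w) \<ge> penobj p M lam mid + (m + m * (a\<^sup>2 / N)) - (m + b\<^sup>2 / 4)
      - 3/2 * h * T * (m + m)"
    using penobj_perturb[OF psds(1) supps(1) psds(2) supps(2), of mid] Npos
    by (simp add: eq[symmetric] trc_rank_one bil_rank_one ww dd power2_eq_square flip: a_def b_def)
  moreover have "m * (a\<^sup>2 / N) - b\<^sup>2 / 4 - 3 * h * T * m \<ge> m * T / 2"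
  proof -
    have "\<alpha>\<^sup>2 \<ge> 1 - 3 * h" by (simp add: \<alpha>_def power2_eq_square algebra_simps)
    then have "1/2 \<le> 2 * \<alpha>\<^sup>2 - 1 - 3 * h" using h by linarith
    then have "m * T * (1/2) \<le> m * T * (2 * \<alpha>\<^sup>2 - 1 - 3 * h)"
      using m0 T_pos by (intro mult_left_mono) auto
    also have "\<dots> = 2 * (m * (\<alpha>\<^sup>2 * T)) - m * T - 3 * h * T * m" by (simp add: algebra_simps)
    also have "\<dots> \<le> 2 * (m * (a\<^sup>2 / N)) - m * T - 3 * h * T * m"
      using mult_left_mono[OF aN m0] by simp
    also have "\<dots> \<le> m * (a\<^sup>2 / N) - b\<^sup>2 / 4 - 3 * h * T * m"
    proof -
      have "2 * P - Q - R \<le> P - B - R" if "B \<le> Q - P" for P Q R B :: real using that by linarith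
      then show ?thesis using bessel unfolding right_diff_distrib by blast
    qed
    finally show ?thesis by simp
  qed
  moreover have "penobj p M lam mid \<ge> 1/2 * penobj p M lam (rank_one 1 u) + 1/2 * penobj p M lam (rank_one 1 v)"
  proof -
    have "frob p M mid = 1/2 * frob p M (rank_one 1 u) + 1/2 * frob p M (rank_one 1 v)"
      by (simp add: frob_def mid_def rank_one_def sum.distrib sum_distrib_left algebra_simps)
    moreover have "l1 p mid \<le> 1/2 * l1 p (rank_one 1 u) + 1/2 * l1 p (rank_one 1 v)"
      unfolding l1_def sum_distrib_left sum.distrib[symmetric]
    proof (intro sum_mono)
      fix j k
      show "\<bar>mid j k\<bar> \<le> 1/2 * \<bar>rank_one 1 u j k\<bar> + 1/2 * \<bar>rank_one 1 v j k\<bar>"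
        by (simp add: mid_def rank_one_def mult.assoc)
    qed
    then have "lam * l1 p mid \<le> lam * (1/2 * l1 p (rank_one 1 u) + 1/2 * l1 p (rank_one 1 v))"
      using lam by (intro mult_left_mono) auto
    ultimately show ?thesis by (simp add: penobj_def algebra_simps)
  qed
  moreover have "penobj p M lam (rank_one (1 / N) w) \<le> penobj p M lam (rank_one 1 u)"
    using max feas unfolding pen_max_def by blast
  ultimately have "m * T \<le> penobj p M lam (rank_one 1 u) - penobj p M lam (rank_one 1 v)"
    by (simp add: algebra_simps)
  then show ?thesis using dd by (simp add: d_def mult.commute)
qed

text \<open>
  If \<open>b = \<sigma> (x \<bullet> u)\<close> were non-positive while \<open>a = \<sigma> (x \<bullet> v)\<close> is positive, then \<open>b\<^sup>2 - a\<^sup>2 \<le> (b - a)\<^sup>2\<close>, whereas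
  \<open>(b - a)\<^sup>2\<close> is controlled by \<open>\<parallel>u - v\<parallel>\<^sup>2\<close> and hence, through stability, by \<open>(b\<^sup>2 - a\<^sup>2) / 4\<close> and the
  selection tolerance \<open>\<eta>\<close>.
\<close>

lemma leave_one_out_sign:
  assumes max: "pen_max p M lam (rank_one 1 u)"
    and u1: "ip p u u = 1" and v1: "ip p v v = 1"
    and suppu: "\<forall>j. j \<notin> S \<longrightarrow> u j = 0" and suppv: "\<forall>j. j \<notin> S \<longrightarrow> v j = 0"
    and u\<theta>: "(1 - 3/2 * h) * sqrt T \<le> ip p u \<theta>" and v\<theta>: "(1 - 3/2 * h) * sqrt T \<le> ip p v \<theta>"
    and n: "0 < n" and \<eta>: "0 \<le> \<eta>"
    and near: "penobj p M lam (rank_one 1 u) - (ip p x u)\<^sup>2 / n - \<eta> \<le> penobj p M lam (rank_one 1 v) - (ip p x v)\<^sup>2 / n"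
    and x: "(\<Sum>j\<in>S. (x j)\<^sup>2) \<le> n * T / 16"
    and \<sigma>: "\<sigma>\<^sup>2 = 1" and margin: "sqrt (n * \<eta>) < \<sigma> * ip p x v"
  shows "0 < \<sigma> * ip p x u"
proof (rule ccontr)
  define d where "d = (\<lambda>j. u j - v j)"
  define a where "a = \<sigma> * ip p x v"
  define b where "b = \<sigma> * ip p x u"
  assume "\<not> 0 < \<sigma> * ip p x u"
  then have b0: "b \<le> 0" by (simp add: b_def)
  have sq: "(ip p x u)\<^sup>2 = b\<^sup>2" "(ip p x v)\<^sup>2 = a\<^sup>2"
    using \<sigma> by (simp_all add: a_def b_def power_mult_distrib)
  have a0: "0 < a" using margin n \<eta> unfolding a_def[symmetric]
    by (meson le_less_trans mult_nonneg_nonneg less_imp_le real_sqrt_ge_zero)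
  have a2: "n * \<eta> < a\<^sup>2"
    using margin n \<eta> a0 unfolding a_def[symmetric]
    by (metis less_imp_le mult_nonneg_nonneg real_sqrt_ge_zero real_sqrt_pow2 power_strict_mono pos2)
  have "(b - a)\<^sup>2 = (ip p x d)\<^sup>2"
  proof -
    have "b - a = \<sigma> * ip p x d" by (simp add: a_def b_def d_def ip_lin algebra_simps)
    then show ?thesis using \<sigma> by (simp add: power_mult_distrib)
  qed
  also have "\<dots> \<le> n * T / 16 * ip p d d"
  proof -
    have "ip p x d = (\<Sum>j\<in>S. x j * d j)" "ip p d d = (\<Sum>j\<in>S. d j * d j)"
      unfolding ip_def d_def using S suppu suppv by (auto intro!: sum.mono_neutral_right)
    then have "(ip p x d)\<^sup>2 \<le> (\<Sum>j\<in>S. (x j)\<^sup>2) * ip p d d"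
      using Cauchy_Schwarz_ineq_sum[of x d S] by (simp add: power2_eq_square)
    also have "\<dots> \<le> n * T / 16 * ip p d d" using x ip_nonneg by (rule mult_right_mono)
    finally show ?thesis .
  qed
  finally have dist: "4 * (b - a)\<^sup>2 \<le> n * (T / 4 * ip p d d)" by simp
  have "T / 4 * ip p d d \<le> \<eta> + (b\<^sup>2 - a\<^sup>2) / n"
    using rank_one_stability[OF max u1 v1 suppu suppv u\<theta> v\<theta>] near
    unfolding d_def sq diff_divide_distrib by linarith
  then have "n * (T / 4 * ip p d d) \<le> n * (\<eta> + (b\<^sup>2 - a\<^sup>2) / n)" using n by (intro mult_left_mono) auto
  also have "\<dots> = n * \<eta> + b\<^sup>2 - a\<^sup>2" using n by (simp add: field_simps)
  finally have "4 * (b - a)\<^sup>2 \<le> n * \<eta> + b\<^sup>2 - a\<^sup>2" using dist by linarith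
  then have "3 * b\<^sup>2 + 5 * a\<^sup>2 \<le> n * \<eta> + 8 * (a * b)" by (simp add: power2_eq_square algebra_simps)
  moreover have "a * b \<le> 0" using a0 b0 by (simp add: mult_le_0_iff)
  moreover have "0 \<le> b\<^sup>2" by simp
  ultimately show False using a2 n \<eta> a0 zero_le_power2[of a] by linarith
qed

end

section \<open>Gaussian tails and products\<close>

lemma prob_space_std_normal: "prob_space (density lborel std_normal_density)"
  by (rule prob_space_normal_density) simp

text \<open>
  Completing the square turns the integrand into a constant times another normal density.
\<close>

lemma nn_integral_exp_quadratic_std_normal:
  assumes b: "b < 1 / 2"
  shows "(\<integral>\<^sup>+ y. ennreal (exp (a * y + b * y\<^sup>2)) \<partial>density lborel std_normal_density)
    = ennreal (exp (a\<^sup>2 / (2 * (1 - 2 * b))) / sqrt (1 - 2 * b))"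
proof -
  define r where "r = 1 - 2 * b"
  have r: "0 < r" using b by (simp add: r_def)
  define K where "K = exp (a\<^sup>2 / (2 * r)) / sqrt r"
  have K: "0 \<le> K" using r by (simp add: K_def)
  have pt: "std_normal_density y * exp (a * y + b * y\<^sup>2) = K * normal_density (a / r) (1 / sqrt r) y" for y
  proof -
    have "exp (- y\<^sup>2 / 2) * exp (a * y + b * y\<^sup>2) = exp (a\<^sup>2 / (2 * r)) * exp (- (y - a / r)\<^sup>2 / (2 * (1 / sqrt r)\<^sup>2))"
    proof -
      have "- y\<^sup>2 / 2 + (a * y + b * y\<^sup>2) = a\<^sup>2 / (2 * r) + - (y - a / r)\<^sup>2 / (2 * (1 / sqrt r)\<^sup>2)"
      proof -
        have b': "b = (1 - r) / 2" by (simp add: r_def)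
        show ?thesis using r unfolding b'
          by (simp add: power_divide power2_eq_square field_simps)
      qed
      then show ?thesis by (simp only: exp_add[symmetric])
    qed
    moreover have "1 / sqrt (2 * pi) = 1 / sqrt r * (1 / sqrt (2 * pi * (1 / sqrt r)\<^sup>2))"
      using r by (simp add: power_divide real_sqrt_divide)
    ultimately show ?thesis
      unfolding std_normal_density_def normal_density_def K_def by simp
  qed
  have "(\<integral>\<^sup>+ y. ennreal (exp (a * y + b * y\<^sup>2)) \<partial>density lborel std_normal_density)
      = (\<integral>\<^sup>+ y. ennreal K * ennreal (normal_density (a / r) (1 / sqrt r) y) \<partial>lborel)"
    using K by (subst nn_integral_density) (auto simp: ennreal_mult[symmetric] pt)
  also have "\<dots> = ennreal K * emeasure (density lborel (normal_density (a / r) (1 / sqrt r))) UNIV"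
    by (subst nn_integral_cmult) (auto simp: emeasure_density)
  also have "\<dots> = ennreal K"
    using prob_space.emeasure_space_1[OF prob_space_normal_density[of "1 / sqrt r" "a / r"]] r by simp
  finally show ?thesis by (simp add: K_def r_def)
qed

lemma chernoff_PiM:
  fixes g :: "'i \<Rightarrow> 'a \<Rightarrow> real"
  assumes I: "finite I" and N: "prob_space N"
    and g[measurable]: "\<And>i. i \<in> I \<Longrightarrow> g i \<in> borel_measurable N"
    and B: "\<And>i. i \<in> I \<Longrightarrow> (\<integral>\<^sup>+ y. ennreal (exp (g i y)) \<partial>N) \<le> ennreal (B i)"
    and B0: "\<And>i. i \<in> I \<Longrightarrow> 0 \<le> B i"
  shows "measure (Pi\<^sub>M I (\<lambda>_. N)) {x \<in> space (Pi\<^sub>M I (\<lambda>_. N)). t \<le> (\<Sum>i\<in>I. g i (x i))}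
           \<le> exp (- t) * (\<Prod>i\<in>I. B i)"
proof -
  let ?P = "Pi\<^sub>M I (\<lambda>_. N)"
  interpret N: prob_space N by (rule N)
  interpret P: product_sigma_finite "\<lambda>_. N" by standard
  interpret PP: prob_space ?P by (intro prob_space_PiM N)
  let ?A = "{x \<in> space ?P. t \<le> (\<Sum>i\<in>I. g i (x i))}"
  have [measurable]: "?A \<in> sets ?P" by measurable
  have "emeasure ?P ?A = (\<integral>\<^sup>+ x. indicator ?A x \<partial>?P)" by simp
  also have "\<dots> \<le> (\<integral>\<^sup>+ x. ennreal (exp (- t)) * (\<Prod>i\<in>I. ennreal (exp (g i (x i)))) \<partial>?P)"
  proof (intro nn_integral_mono)
    fix x
    have "ennreal 1 \<le> ennreal (exp (- t) * exp (\<Sum>i\<in>I. g i (x i)))" if "t \<le> (\<Sum>i\<in>I. g i (x i))"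
      using that by (intro ennreal_leI) (simp flip: exp_add)
    moreover have "ennreal (exp (- t) * exp (\<Sum>i\<in>I. g i (x i))) = ennreal (exp (- t)) * (\<Prod>i\<in>I. ennreal (exp (g i (x i))))"
      using I by (simp add: prod_ennreal exp_sum ennreal_mult prod_nonneg)
    ultimately show "indicator ?A x \<le> ennreal (exp (- t)) * (\<Prod>i\<in>I. ennreal (exp (g i (x i))))"
      by (auto simp: indicator_def)
  qed
  also have "\<dots> = ennreal (exp (- t)) * (\<Prod>i\<in>I. \<integral>\<^sup>+ y. ennreal (exp (g i y)) \<partial>N)"
    using I by (subst nn_integral_cmult, measurable, subst P.product_nn_integral_prod) auto
  also have "\<dots> \<le> ennreal (exp (- t)) * (\<Prod>i\<in>I. ennreal (B i))"
    using B by (intro mult_left_mono prod_mono_ennreal) auto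
  also have "\<dots> = ennreal (exp (- t) * (\<Prod>i\<in>I. B i))"
    using B0 by (simp add: prod_ennreal ennreal_mult prod_nonneg)
  finally show ?thesis
    using B0 by (simp add: PP.emeasure_eq_measure prod_nonneg)
qed

text \<open>
  Conditioning on all coordinates but \<open>i\<close>, by Tonelli.  It serves for events in which the remaining
  coordinates select a test direction for coordinate \<open>i\<close>.
\<close>

lemma measure_PiM_le_sections:
  assumes I: "finite I" "i \<in> I" and N: "prob_space N"
    and Q: "Q \<in> sets (Pi\<^sub>M I (\<lambda>_. N))"
    and c: "\<And>x. x \<in> space (Pi\<^sub>M (I - {i}) (\<lambda>_. N)) \<Longrightarrow> measure N {y \<in> space N. x(i := y) \<in> Q} \<le> c"
  shows "measure (Pi\<^sub>M I (\<lambda>_. N)) Q \<le> c"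
proof -
  let ?J = "I - {i}"
  interpret N: prob_space N by (rule N)
  interpret P: product_sigma_finite "\<lambda>_. N" by standard
  interpret PP: prob_space "Pi\<^sub>M I (\<lambda>_. N)" by (intro prob_space_PiM N)
  interpret PJ: prob_space "Pi\<^sub>M ?J (\<lambda>_. N)" by (intro prob_space_PiM N)
  have I_eq: "insert i ?J = I" using I by auto
  have "emeasure (Pi\<^sub>M I (\<lambda>_. N)) Q = (\<integral>\<^sup>+ x. indicator Q x \<partial>Pi\<^sub>M (insert i ?J) (\<lambda>_. N))"
    unfolding I_eq using Q by simp
  also have "\<dots> = (\<integral>\<^sup>+ x. (\<integral>\<^sup>+ y. indicator Q (x(i := y)) \<partial>N) \<partial>Pi\<^sub>M ?J (\<lambda>_. N))"
    using I Q by (intro P.product_nn_integral_insert) (auto simp: insert_absorb)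
  also have "\<dots> \<le> (\<integral>\<^sup>+ x. ennreal c \<partial>Pi\<^sub>M ?J (\<lambda>_. N))"
  proof (intro nn_integral_mono)
    fix x assume x: "x \<in> space (Pi\<^sub>M ?J (\<lambda>_. N))"
    let ?A = "{y \<in> space N. x(i := y) \<in> Q}"
    have "(\<lambda>y. x(i := y)) \<in> measurable N (Pi\<^sub>M (insert i ?J) (\<lambda>_. N))"
      using x by (intro measurable_component_update) auto
    then have "(\<lambda>y. x(i := y)) \<in> measurable N (Pi\<^sub>M I (\<lambda>_. N))" unfolding I_eq .
    from measurable_sets[OF this Q] have A: "?A \<in> sets N"
      by (simp add: vimage_def Int_def conj_commute)
    have "(\<integral>\<^sup>+ y. indicator Q (x(i := y)) \<partial>N) = (\<integral>\<^sup>+ y. indicator ?A y \<partial>N)"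
      by (intro nn_integral_cong) (auto simp: indicator_def)
    also have "\<dots> = ennreal (measure N ?A)" using A by (simp add: N.emeasure_eq_measure)
    also have "\<dots> \<le> ennreal c" using c[OF x] by (rule ennreal_leI)
    finally show "(\<integral>\<^sup>+ y. indicator Q (x(i := y)) \<partial>N) \<le> ennreal c" .
  qed
  also have "\<dots> = ennreal c" by (simp add: PJ.emeasure_space_1)
  finally have le: "ennreal (measure (Pi\<^sub>M I (\<lambda>_. N)) Q) \<le> ennreal c"
    by (simp add: PP.emeasure_eq_measure)
  have "0 \<le> c"
  proof -
    obtain x where "x \<in> space (Pi\<^sub>M ?J (\<lambda>_. N))" using PJ.not_empty by blast
    from c[OF this] show ?thesis using measure_nonneg order.trans by blast
  qed
  then show ?thesis using le by simp
qed

lemma (in prob_space) markov_count: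
  assumes A: "\<And>i. i < n \<Longrightarrow> A i \<in> events" and b: "\<And>i. i < n \<Longrightarrow> prob (A i) \<le> b" and a: "0 < a"
  shows "prob {\<omega> \<in> space M. a \<le> (\<Sum>i<n. indicator (A i) \<omega>)} \<le> real n * b / a"
proof -
  have int: "integrable M (\<lambda>\<omega>. \<Sum>i<n. indicator (A i) \<omega> :: real)"
    using A by (intro Bochner_Integration.integrable_sum integrable_real_indicator) (auto simp: emeasure_eq_measure)
  have "(\<integral>\<omega>. (\<Sum>i<n. indicator (A i) \<omega>) \<partial>M) = (\<Sum>i<n. prob (A i))"
    using A by (subst Bochner_Integration.integral_sum)
      (auto simp: emeasure_eq_measure intro!: integrable_real_indicator)
  also have "\<dots> \<le> (\<Sum>i<n. b)" using b by (intro sum_mono) auto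
  finally have "(\<integral>\<omega>. (\<Sum>i<n. indicator (A i) \<omega>) \<partial>M) \<le> real n * b" by simp
  then have "(\<integral>\<omega>. (\<Sum>i<n. indicator (A i) \<omega>) \<partial>M) / a \<le> real n * b / a"
    using a by (simp add: divide_right_mono)
  moreover have "prob {\<omega> \<in> space M. a \<le> (\<Sum>i<n. indicator (A i) \<omega>)}
      \<le> (\<integral>\<omega>. (\<Sum>i<n. indicator (A i) \<omega>) \<partial>M) / a"
    using int a by (intro integral_Markov_inequality_measure[of M _ "{}"]) (auto simp: sum_nonneg)
  ultimately show ?thesis by linarith
qed

lemma prob_space_std_gaussian: "prob_space (std_gaussian p)"
  unfolding std_gaussian_def by (intro prob_space_PiM prob_space_std_normal)

lemma prob_space_noise: "prob_space (noise p n)"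
  unfolding noise_def by (intro prob_space_PiM prob_space_std_gaussian)

lemma measurable_std_gaussian_component[measurable]:
  "j < p \<Longrightarrow> (\<lambda>y. y j) \<in> borel_measurable (std_gaussian p)"
  unfolding std_gaussian_def
  using measurable_component_singleton[of j "{..<p}" "\<lambda>_. density lborel std_normal_density"] by simp

lemma measurable_noise_component:
  "i < n \<Longrightarrow> (\<lambda>\<epsilon>. \<epsilon> i) \<in> measurable (noise p n) (std_gaussian p)"
  unfolding noise_def using measurable_component_singleton[of i "{..<n}" "\<lambda>_. std_gaussian p"] by simp

lemma measurable_noise_entry[measurable]:
  "i < n \<Longrightarrow> j < p \<Longrightarrow> (\<lambda>\<epsilon>. \<epsilon> i j) \<in> borel_measurable (noise p n)"
  using measurable_compose[OF measurable_noise_component measurable_std_gaussian_component] .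

lemma gaussian_projection_tail:
  assumes v: "ip p v v = 1" and \<sigma>: "\<sigma>\<^sup>2 = 1" and x: "0 \<le> x"
  shows "measure (std_gaussian p) {y \<in> space (std_gaussian p). \<sigma> * ip p v y \<le> - x} \<le> exp (- x\<^sup>2 / 2)"
proof -
  interpret prob_space "std_gaussian p" by (rule prob_space_std_gaussian)
  define g where "g = (\<lambda>j y. - x * \<sigma> * v j * (y :: real))"
  have "measure (std_gaussian p) {y \<in> space (std_gaussian p). \<sigma> * ip p v y \<le> - x}
      \<le> measure (std_gaussian p) {y \<in> space (std_gaussian p). x\<^sup>2 \<le> (\<Sum>j<p. g j (y j))}"
  proof (rule finite_measure_mono)
    have "(\<Sum>j<p. g j (y j)) = - x * (\<sigma> * ip p v y)" for y
      by (simp add: g_def ip_def sum_distrib_left sum_negf mult.assoc)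
    moreover have "x\<^sup>2 \<le> - x * w" if "w \<le> - x" for w
      using mult_left_mono[OF that x] by (simp add: power2_eq_square)
    ultimately show "{y \<in> space (std_gaussian p). \<sigma> * ip p v y \<le> - x}
      \<subseteq> {y \<in> space (std_gaussian p). x\<^sup>2 \<le> (\<Sum>j<p. g j (y j))}" by auto
    show "{y \<in> space (std_gaussian p). x\<^sup>2 \<le> (\<Sum>j<p. g j (y j))} \<in> events"
      unfolding g_def by measurable
  qed
  also have "\<dots> \<le> exp (- x\<^sup>2) * (\<Prod>j<p. exp (x\<^sup>2 * (v j * v j) / 2))"
    unfolding std_gaussian_def
  proof (intro chernoff_PiM)
    fix j
    show "g j \<in> borel_measurable (density lborel std_normal_density)" by (simp add: g_def)
    show "(\<integral>\<^sup>+ y. ennreal (exp (g j y)) \<partial>density lborel std_normal_density)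
        \<le> ennreal (exp (x\<^sup>2 * (v j * v j) / 2))"
      using nn_integral_exp_quadratic_std_normal[of 0 "- x * \<sigma> * v j"] \<sigma>
      by (simp add: g_def power_mult_distrib power2_eq_square[of "v j"])
  qed (auto intro: prob_space_std_normal)
  also have "\<dots> = exp (- x\<^sup>2 / 2)"
    using v by (simp flip: exp_sum exp_add sum_divide_distrib sum_distrib_left add: ip_def)
  finally show ?thesis .
qed

lemma gaussian_norm_tail:
  assumes S: "S \<subseteq> {..<p}"
  shows "measure (std_gaussian p) {y \<in> space (std_gaussian p). t \<le> (\<Sum>j\<in>S. (y j)\<^sup>2)}
           \<le> exp (- t / 4) * sqrt 2 ^ card S"
proof -
  define g where "g = (\<lambda>j y. if j \<in> S then (y :: real)\<^sup>2 / 4 else 0)"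
  have fin: "finite S" using S finite_subset by blast
  have "(\<Sum>j<p. g j (y j)) = (\<Sum>j\<in>S. (y j)\<^sup>2) / 4" for y
  proof -
    have "(\<Sum>j<p. g j (y j)) = (\<Sum>j\<in>{..<p} \<inter> S. (y j)\<^sup>2 / 4)"
      unfolding g_def by (simp add: sum.inter_restrict)
    then show ?thesis using S by (simp add: Int_absorb1 sum_divide_distrib)
  qed
  then have "{y \<in> space (std_gaussian p). t \<le> (\<Sum>j\<in>S. (y j)\<^sup>2)}
      = {y \<in> space (std_gaussian p). t / 4 \<le> (\<Sum>j<p. g j (y j))}" by simp
  also have "measure (std_gaussian p) \<dots> \<le> exp (- (t / 4)) * (\<Prod>j<p. if j \<in> S then sqrt 2 else 1)"
    unfolding std_gaussian_def
  proof (intro chernoff_PiM)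
    fix j
    show "g j \<in> borel_measurable (density lborel std_normal_density)" by (simp add: g_def)
    have "(1::real) / sqrt (1 - 2 * (1/4)) = sqrt 2" by (simp add: real_sqrt_divide)
    then show "(\<integral>\<^sup>+ y. ennreal (exp (g j y)) \<partial>density lborel std_normal_density)
        \<le> ennreal (if j \<in> S then sqrt 2 else 1)"
      using nn_integral_exp_quadratic_std_normal[of "1/4" 0]
        prob_space.emeasure_space_1[OF prob_space_std_normal]
      by (simp add: g_def)
  qed (auto intro: prob_space_std_normal)
  also have "(\<Prod>j<p. if j \<in> S then sqrt 2 else 1) = sqrt 2 ^ card S"
  proof -
    have "(\<Prod>j<p. if j \<in> S then sqrt 2 else 1) = (\<Prod>j\<in>{..<p} \<inter> S. sqrt 2)"
      by (simp add: prod.If_cases)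
    then show ?thesis using S by (simp add: Int_absorb1)
  qed
  finally show ?thesis by simp
qed

lemma nn_integral_std_gaussian_component:
  assumes "j < p" "f \<in> borel_measurable borel"
  shows "(\<integral>\<^sup>+ y. f (y j) \<partial>std_gaussian p) = (\<integral>\<^sup>+ y. f y \<partial>density lborel std_normal_density)"
proof -
  have "distr (std_gaussian p) (density lborel std_normal_density) (\<lambda>y. y j) = density lborel std_normal_density"
    unfolding std_gaussian_def using assms(1)
    by (intro distr_PiM_component) (auto intro: prob_space_std_normal)
  then have "(\<integral>\<^sup>+ y. f y \<partial>density lborel std_normal_density)
      = (\<integral>\<^sup>+ y. f y \<partial>distr (std_gaussian p) (density lborel std_normal_density) (\<lambda>y. y j))" by simp
  also have "\<dots> = (\<integral>\<^sup>+ y. f (y j) \<partial>std_gaussian p)"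
    using assms by (intro nn_integral_distr) auto
  finally show ?thesis by simp
qed

lemma inverse_sqrt_le_exp:
  assumes x: "\<bar>x\<bar> \<le> 1 / 2"
  shows "1 / sqrt (1 - x) \<le> exp (x / 2 + x\<^sup>2)"
proof -
  have pos: "0 < 1 - x" using x by auto
  have "\<bar>ln (1 + (- x)) - (- x)\<bar> \<le> 2 * (- x)\<^sup>2"
    using x by (intro abs_ln_one_plus_x_minus_x_bound) auto
  then have "- x - 2 * x\<^sup>2 \<le> ln (1 - x)" by (auto simp: abs_le_iff)
  then have "exp (- x - 2 * x\<^sup>2) \<le> 1 - x" using pos ln_ge_iff by blast
  then have "sqrt (exp (- x - 2 * x\<^sup>2)) \<le> sqrt (1 - x)" by simp
  moreover have "sqrt (exp (- x - 2 * x\<^sup>2)) = exp (- (x / 2 + x\<^sup>2))"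
    by (rule real_sqrt_unique) (simp_all add: power2_eq_square flip: exp_add)
  ultimately have "exp (- (x / 2 + x\<^sup>2)) \<le> sqrt (1 - x)" by simp
  then have "exp (- (x / 2 + x\<^sup>2)) * exp (x / 2 + x\<^sup>2) \<le> sqrt (1 - x) * exp (x / 2 + x\<^sup>2)"
    by (intro mult_right_mono) auto
  then have "1 \<le> sqrt (1 - x) * exp (x / 2 + x\<^sup>2)" by (simp flip: exp_add)
  then show ?thesis using pos by (simp add: field_simps)
qed

text \<open>
  Off the diagonal, integrating out \<open>y k\<close> first leaves a Gaussian integral of \<open>exp (\<mu>\<^sup>2 (y j)\<^sup>2 / 2)\<close>.
  The common bound keeps the union bound over all pairs uniform.
\<close>

lemma mgf_gaussian_product:
  assumes j: "j < p" and k: "k < p" and \<mu>: "\<bar>\<mu>\<bar> \<le> 1 / 4"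
  shows "(\<integral>\<^sup>+ y. ennreal (exp (\<mu> * (y j * y k - of_bool (j = k)))) \<partial>std_gaussian p) \<le> ennreal (exp (4 * \<mu>\<^sup>2))"
proof (cases "j = k")
  case True
  have "(\<integral>\<^sup>+ y. ennreal (exp (\<mu> * (y j * y k - of_bool (j = k)))) \<partial>std_gaussian p)
      = (\<integral>\<^sup>+ y. ennreal (exp (- \<mu>)) * ennreal (exp (\<mu> * (y j)\<^sup>2)) \<partial>std_gaussian p)"
    using True by (intro nn_integral_cong)
      (simp add: power2_eq_square algebra_simps flip: ennreal_mult exp_add)
  also have "\<dots> = ennreal (exp (- \<mu>)) * ennreal (1 / sqrt (1 - 2 * \<mu>))"
    using nn_integral_exp_quadratic_std_normal[of \<mu> 0] \<mu> j
    by (subst nn_integral_cmult, measurable) (simp add: nn_integral_std_gaussian_component[of j p "\<lambda>y. ennreal (exp (\<mu> * y\<^sup>2))"])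
  also have "\<dots> = ennreal (exp (- \<mu>) * (1 / sqrt (1 - 2 * \<mu>)))"
    using \<mu> by (intro ennreal_mult[symmetric]) auto
  also have "\<dots> \<le> ennreal (exp (- \<mu>) * exp (2 * \<mu> / 2 + (2 * \<mu>)\<^sup>2))"
    using \<mu> by (intro ennreal_leI mult_left_mono inverse_sqrt_le_exp) auto
  also have "exp (- \<mu>) * exp (2 * \<mu> / 2 + (2 * \<mu>)\<^sup>2) = exp (4 * \<mu>\<^sup>2)"
    by (simp add: power2_eq_square flip: exp_add)
  finally show ?thesis .
next
  case False
  interpret N: prob_space "density lborel std_normal_density" by (rule prob_space_std_normal)
  interpret P: product_sigma_finite "\<lambda>_. density lborel std_normal_density" by standard
  define J where "J = {..<p} - {k}"
  have J: "finite J" "k \<notin> J" "insert k J = {..<p}" "j \<in> J" using j k False by (auto simp: J_def)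
  have \<mu>2: "\<mu>\<^sup>2 \<le> (1/4)\<^sup>2" using \<mu> by (metis abs_ge_zero power2_abs power_mono)
  then have \<mu>2': "\<mu>\<^sup>2 \<le> 1 / 2" by (simp add: power2_eq_square[of "1 / 4 :: real"])
  then have b: "\<mu>\<^sup>2 / 2 < 1 / 2" by simp
  have "(\<integral>\<^sup>+ y. ennreal (exp (\<mu> * (y j * y k - of_bool (j = k)))) \<partial>std_gaussian p)
      = (\<integral>\<^sup>+ y. ennreal (exp (\<mu> * (y j * y k))) \<partial>Pi\<^sub>M (insert k J) (\<lambda>_. density lborel std_normal_density))"
    using False by (simp add: std_gaussian_def J(3))
  also have "\<dots> = (\<integral>\<^sup>+ x. (\<integral>\<^sup>+ y. ennreal (exp (\<mu> * ((x(k := y)) j * (x(k := y)) k))) \<partial>density lborel std_normal_density)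
      \<partial>Pi\<^sub>M J (\<lambda>_. density lborel std_normal_density))"
  proof (intro P.product_nn_integral_insert J)
    have "(\<lambda>y. ennreal (exp (\<mu> * (y j * y k)))) \<in> borel_measurable (std_gaussian p)"
      using j k by measurable
    then show "(\<lambda>y. ennreal (exp (\<mu> * (y j * y k)))) \<in> borel_measurable (Pi\<^sub>M (insert k J) (\<lambda>_. density lborel std_normal_density))"
      by (simp add: std_gaussian_def J(3))
  qed
  also have "\<dots> = (\<integral>\<^sup>+ x. (\<Prod>i\<in>J. if i = j then ennreal (exp (\<mu>\<^sup>2 / 2 * (x i)\<^sup>2)) else 1)
      \<partial>Pi\<^sub>M J (\<lambda>_. density lborel std_normal_density))"
  proof (intro nn_integral_cong)
    fix x :: "nat \<Rightarrow> real"
    have "(\<integral>\<^sup>+ y. ennreal (exp (\<mu> * ((x(k := y)) j * (x(k := y)) k))) \<partial>density lborel std_normal_density)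
      = (\<integral>\<^sup>+ y. ennreal (exp ((\<mu> * x j) * y + 0 * y\<^sup>2)) \<partial>density lborel std_normal_density)"
      using False by (simp add: mult.assoc)
    also have "\<dots> = ennreal (exp (\<mu>\<^sup>2 / 2 * (x j)\<^sup>2))"
      by (subst nn_integral_exp_quadratic_std_normal) (auto simp: power_mult_distrib)
    also have "\<dots> = (\<Prod>i\<in>J. if i = j then ennreal (exp (\<mu>\<^sup>2 / 2 * (x i)\<^sup>2)) else 1)"
      using J by simp
    finally show "(\<integral>\<^sup>+ y. ennreal (exp (\<mu> * ((x(k := y)) j * (x(k := y)) k))) \<partial>density lborel std_normal_density)
      = (\<Prod>i\<in>J. if i = j then ennreal (exp (\<mu>\<^sup>2 / 2 * (x i)\<^sup>2)) else 1)" .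
  qed
  also have "\<dots> = (\<Prod>i\<in>J. \<integral>\<^sup>+ y. (if i = j then ennreal (exp (\<mu>\<^sup>2 / 2 * y\<^sup>2)) else 1) \<partial>density lborel std_normal_density)"
    using J by (intro P.product_nn_integral_prod) auto
  also have "\<dots> = (\<Prod>i\<in>J. if i = j then ennreal (1 / sqrt (1 - \<mu>\<^sup>2)) else 1)"
    using nn_integral_exp_quadratic_std_normal[OF b, of 0] N.emeasure_space_1
    by (intro prod.cong refl) auto
  also have "\<dots> = ennreal (1 / sqrt (1 - \<mu>\<^sup>2))" using J by simp
  also have "\<dots> \<le> ennreal (exp (4 * \<mu>\<^sup>2))"
  proof (intro ennreal_leI)
    have "1 / sqrt (1 - \<mu>\<^sup>2) \<le> exp (\<mu>\<^sup>2 / 2 + (\<mu>\<^sup>2)\<^sup>2)"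
      using \<mu>2' by (intro inverse_sqrt_le_exp) simp
    moreover have "(\<mu>\<^sup>2)\<^sup>2 \<le> \<mu>\<^sup>2 * 1"
      unfolding power2_eq_square[of "\<mu>\<^sup>2"] using \<mu>2' by (intro mult_left_mono) auto
    then have "\<mu>\<^sup>2 / 2 + (\<mu>\<^sup>2)\<^sup>2 \<le> 4 * \<mu>\<^sup>2" using zero_le_power2[of \<mu>] by linarith
    then have "exp (\<mu>\<^sup>2 / 2 + (\<mu>\<^sup>2)\<^sup>2) \<le> exp (4 * \<mu>\<^sup>2)" by (rule exp_le_cancel_iff[THEN iffD2])
    ultimately show "1 / sqrt (1 - \<mu>\<^sup>2) \<le> exp (4 * \<mu>\<^sup>2)" by linarith
  qed
  finally show ?thesis .
qed

section \<open>Second moments of the observations\<close>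

definition obs :: "(nat \<Rightarrow> real) \<Rightarrow> (nat \<Rightarrow> real) \<Rightarrow> (nat \<Rightarrow> nat \<Rightarrow> real) \<Rightarrow> nat \<Rightarrow> nat \<Rightarrow> real" where
  "obs z \<theta> \<epsilon> i j = z i * \<theta> j + \<epsilon> i j"

definition gram :: "nat \<Rightarrow> (nat \<Rightarrow> nat \<Rightarrow> real) \<Rightarrow> nat \<Rightarrow> nat \<Rightarrow> real" where
  "gram n X j k = (\<Sum>i<n. X i j * X i k) / real n"

text \<open>
  The penalised objective at \<open>vv\<^sup>T\<close> without the contribution of observation \<open>i\<close>, but with the
  normalisation \<open>1 / n\<close> of the full sample, so that the two objectives differ by exactly one summand.
\<close>

definition loo_obj :: "nat \<Rightarrow> nat \<Rightarrow> real \<Rightarrow> (nat \<Rightarrow> nat \<Rightarrow> real) \<Rightarrow> nat \<Rightarrow> (nat \<Rightarrow> real) \<Rightarrow> real" where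
  "loo_obj p n lam X i v = (\<Sum>l\<in>{..<n} - {i}. (ip p (X l) v)\<^sup>2) / real n - lam * (\<Sum>j<p. \<bar>v j\<bar>)\<^sup>2"

lemma penobj_gram_rank_one:
  "penobj p (gram n X) lam (rank_one 1 v) = (\<Sum>i<n. (ip p (X i) v)\<^sup>2) / real n - lam * (\<Sum>j<p. \<bar>v j\<bar>)\<^sup>2"
proof -
  have "frob p (gram n X) (rank_one 1 v) = (\<Sum>j<p. \<Sum>k<p. \<Sum>i<n. (X i j * v j) * (X i k * v k) / real n)"
    unfolding frob_def gram_def rank_one_def
    by (intro sum.cong refl) (simp add: sum_distrib_left sum_distrib_right sum_divide_distrib mult_ac)
  also have "\<dots> = (\<Sum>j<p. \<Sum>i<n. \<Sum>k<p. (X i j * v j) * (X i k * v k) / real n)"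
    by (rule sum.cong[OF refl]) (rule sum.swap)
  also have "\<dots> = (\<Sum>i<n. \<Sum>j<p. \<Sum>k<p. (X i j * v j) * (X i k * v k) / real n)"
    by (rule sum.swap)
  also have "\<dots> = (\<Sum>i<n. (ip p (X i) v)\<^sup>2 / real n)"
    by (simp add: ip_def power2_eq_square sum_product flip: sum_divide_distrib)
  finally have "frob p (gram n X) (rank_one 1 v) = (\<Sum>i<n. (ip p (X i) v)\<^sup>2) / real n"
    by (simp add: sum_divide_distrib)
  moreover have "l1 p (rank_one 1 v) = (\<Sum>j<p. \<bar>v j\<bar>)\<^sup>2"
    by (simp add: l1_def rank_one_def abs_mult power2_eq_square sum_product)
  ultimately show ?thesis by (simp add: penobj_def)
qed

lemma loo_obj_eq:
  assumes "i < n"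
  shows "loo_obj p n lam X i v = penobj p (gram n X) lam (rank_one 1 v) - (ip p (X i) v)\<^sup>2 / real n"
  using assms by (simp add: loo_obj_def penobj_gram_rank_one sum_diff1 diff_divide_distrib)

lemma loo_obj_cong:
  assumes "\<And>l. l < n \<Longrightarrow> l \<noteq> i \<Longrightarrow> X l = Y l"
  shows "loo_obj p n lam X i = loo_obj p n lam Y i"
proof
  fix v
  have "(\<Sum>l\<in>{..<n} - {i}. (ip p (X l) v)\<^sup>2) = (\<Sum>l\<in>{..<n} - {i}. (ip p (Y l) v)\<^sup>2)"
    using assms by (intro sum.cong) auto
  then show "loo_obj p n lam X i v = loo_obj p n lam Y i v" by (simp add: loo_obj_def)
qed

lemma loo_obj_bounded:
  assumes "0 \<le> lam" "ip p v v = 1"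
  shows "loo_obj p n lam X i v \<le> (\<Sum>l\<in>{..<n} - {i}. ip p (X l) (X l)) / real n"
proof -
  have "(\<Sum>l\<in>{..<n} - {i}. (ip p (X l) v)\<^sup>2) \<le> (\<Sum>l\<in>{..<n} - {i}. ip p (X l) (X l))"
    using ip_Cauchy_Schwarz[of p _ v] assms(2) by (intro sum_mono) simp
  moreover have "0 \<le> lam * (\<Sum>j<p. \<bar>v j\<bar>)\<^sup>2" using assms(1) by simp
  ultimately show ?thesis unfolding loo_obj_def
    by (smt (verit) divide_right_mono of_nat_0_le_iff)
qed

lemma continuous_on_loo_obj: "continuous_on UNIV (loo_obj p n lam X i)"
  unfolding loo_obj_def[abs_def] ip_def divide_inverse
  by (intro continuous_intros continuous_on_product_coordinates)

lemma gram_deviation: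
  assumes n: "0 < n" and q: "0 \<le> q"
    and z: "\<And>i. i < n \<Longrightarrow> z i * z i = 1"
    and \<theta>: "\<bar>\<theta> j\<bar> \<le> \<kappa>" "\<bar>\<theta> k\<bar> \<le> \<kappa>"
    and d1: "\<bar>\<Sum>i<n. z i * \<epsilon> i j\<bar> \<le> 2 * real n * q" "\<bar>\<Sum>i<n. z i * \<epsilon> i k\<bar> \<le> 2 * real n * q"
    and d2: "\<bar>\<Sum>i<n. \<epsilon> i j * \<epsilon> i k - of_bool (j = k)\<bar> \<le> 13 * real n * q"
  shows "\<bar>gram n (obs z \<theta> \<epsilon>) j k - of_bool (j = k) - \<theta> j * \<theta> k\<bar> \<le> 13 * (1 + \<kappa>) * q"
proof -
  define U where "U = (\<Sum>i<n. z i * \<epsilon> i j)"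
  define V where "V = (\<Sum>i<n. z i * \<epsilon> i k)"
  define W where "W = (\<Sum>i<n. \<epsilon> i j * \<epsilon> i k - of_bool (j = k))"
  have \<kappa>: "0 \<le> \<kappa>" using \<theta>(1) by linarith
  have "(\<Sum>i<n. obs z \<theta> \<epsilon> i j * obs z \<theta> \<epsilon> i k)
      = (\<Sum>i<n. \<theta> j * \<theta> k + of_bool (j = k) + \<theta> j * (z i * \<epsilon> i k) + \<theta> k * (z i * \<epsilon> i j) + (\<epsilon> i j * \<epsilon> i k - of_bool (j = k)))"
  proof (intro sum.cong refl)
    fix i assume "i \<in> {..<n}"
    then have zz: "z i * z i = 1" using z by simp
    have "obs z \<theta> \<epsilon> i j * obs z \<theta> \<epsilon> i k
        = (z i * z i) * (\<theta> j * \<theta> k) + \<theta> j * (z i * \<epsilon> i k) + \<theta> k * (z i * \<epsilon> i j) + \<epsilon> i j * \<epsilon> i k"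
      by (simp add: obs_def algebra_simps)
    then show "obs z \<theta> \<epsilon> i j * obs z \<theta> \<epsilon> i k
      = \<theta> j * \<theta> k + of_bool (j = k) + \<theta> j * (z i * \<epsilon> i k) + \<theta> k * (z i * \<epsilon> i j) + (\<epsilon> i j * \<epsilon> i k - of_bool (j = k))"
      unfolding zz by simp
  qed
  also have "\<dots> = n * (\<theta> j * \<theta> k) + n * of_bool (j = k) + \<theta> j * V + \<theta> k * U + W"
    by (simp only: sum.distrib sum_distrib_left[symmetric] U_def V_def W_def) simp
  finally have "gram n (obs z \<theta> \<epsilon>) j k - of_bool (j = k) - \<theta> j * \<theta> k = (\<theta> j * V + \<theta> k * U + W) / n"
    using n by (simp add: gram_def add_divide_distrib)
  moreover have "\<bar>\<theta> j * V + \<theta> k * U + W\<bar> \<le> n * (13 * (1 + \<kappa>) * q)"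
  proof -
    have "\<bar>\<theta> j * V\<bar> \<le> \<kappa> * (2 * n * q)" "\<bar>\<theta> k * U\<bar> \<le> \<kappa> * (2 * n * q)"
      unfolding abs_mult using \<theta> d1 \<kappa> by (auto intro!: mult_mono simp: U_def V_def)
    moreover have "\<bar>W\<bar> \<le> 13 * n * q" using d2 by (simp add: W_def)
    moreover have "\<kappa> * (2 * n * q) = 2 * (n * \<kappa> * q)" by simp
    ultimately have "\<bar>\<theta> j * V + \<theta> k * U + W\<bar> \<le> 4 * (n * \<kappa> * q) + 13 * n * q" by linarith
    also have "\<dots> \<le> 13 * (n * \<kappa> * q) + 13 * n * q"
    proof -
      have "0 \<le> n * \<kappa> * q" using \<kappa> q by simp
      then show ?thesis by linarith
    qed
    finally show ?thesis by (simp add: algebra_simps)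
  qed
  ultimately show ?thesis using n by (simp add: abs_divide divide_le_eq mult.commute)
qed

lemma iid_sum_tail:
  fixes g :: "nat \<Rightarrow> (nat \<Rightarrow> real) \<Rightarrow> real"
  assumes g: "\<And>i. i < n \<Longrightarrow> g i \<in> borel_measurable (std_gaussian p)"
    and mgf: "\<And>i. i < n \<Longrightarrow> (\<integral>\<^sup>+ y. ennreal (exp (\<mu> * g i y)) \<partial>std_gaussian p) \<le> ennreal (exp b)"
    and \<mu>: "0 < \<mu>"
  shows "measure (noise p n) {\<epsilon> \<in> space (noise p n). t \<le> (\<Sum>i<n. g i (\<epsilon> i))} \<le> exp (n * b - \<mu> * t)"
proof -
  have "{\<epsilon> \<in> space (noise p n). t \<le> (\<Sum>i<n. g i (\<epsilon> i))}
      = {\<epsilon> \<in> space (noise p n). \<mu> * t \<le> (\<Sum>i<n. \<mu> * g i (\<epsilon> i))}"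
    using \<mu> by (simp flip: sum_distrib_left)
  also have "measure (noise p n) \<dots> \<le> exp (- (\<mu> * t)) * (\<Prod>i<n. exp b)"
    unfolding noise_def using g mgf by (intro chernoff_PiM) (auto intro: prob_space_std_gaussian)
  also have "\<dots> = exp (n * b - \<mu> * t)"
    by (simp add: exp_of_nat_mult[symmetric] exp_add[symmetric])
  finally show ?thesis .
qed

lemma iid_sum_tail_abs:
  fixes g :: "nat \<Rightarrow> (nat \<Rightarrow> real) \<Rightarrow> real"
  assumes g[measurable]: "\<And>i. i < n \<Longrightarrow> g i \<in> borel_measurable (std_gaussian p)"
    and mgf: "\<And>i \<sigma>. i < n \<Longrightarrow> \<sigma> \<in> {- 1, 1} \<Longrightarrow> (\<integral>\<^sup>+ y. ennreal (exp (\<sigma> * \<mu> * g i y)) \<partial>std_gaussian p) \<le> ennreal (exp b)"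
    and \<mu>: "0 < \<mu>"
  shows "measure (noise p n) {\<epsilon> \<in> space (noise p n). t \<le> \<bar>\<Sum>i<n. g i (\<epsilon> i)\<bar>} \<le> 2 * exp (n * b - \<mu> * t)"
proof -
  interpret prob_space "noise p n" by (rule prob_space_noise)
  have [measurable]: "(\<lambda>\<epsilon>. g i (\<epsilon> i)) \<in> borel_measurable (noise p n)" if "i < n" for i
    using measurable_compose[OF measurable_noise_component[OF that] g[OF that]] .
  let ?A = "\<lambda>\<sigma>. {\<epsilon> \<in> space (noise p n). t \<le> (\<Sum>i<n. \<sigma> * g i (\<epsilon> i))}"
  have "measure (noise p n) {\<epsilon> \<in> space (noise p n). t \<le> \<bar>\<Sum>i<n. g i (\<epsilon> i)\<bar>} \<le> prob (?A 1 \<union> ?A (- 1))"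
    by (intro finite_measure_mono) (auto simp: sum_negf)
  also have "\<dots> \<le> prob (?A 1) + prob (?A (- 1))"
    by (intro measure_Un_le) measurable
  also have "\<dots> \<le> exp (n * b - \<mu> * t) + exp (n * b - \<mu> * t)"
    using mgf[of _ 1] mgf[of _ "- 1"] \<mu> by (intro add_mono iid_sum_tail) (auto simp: mult_ac)
  finally show ?thesis by simp
qed

text \<open>
  The two kinds of sums are the parts of the noise in the second moments: the cross terms with \<open>\<theta>\<close> and the
  centred noise moments.  Here \<open>q\<close> stands for \<open>sqrt (log p / n)\<close>.
\<close>

definition moments_close :: "nat \<Rightarrow> nat \<Rightarrow> (nat \<Rightarrow> real) \<Rightarrow> real \<Rightarrow> (nat \<Rightarrow> nat \<Rightarrow> real) \<Rightarrow> bool" where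
  "moments_close p n z q \<epsilon> \<longleftrightarrow>
     (\<forall>k<p. \<bar>\<Sum>i<n. z i * \<epsilon> i k\<bar> \<le> 2 * real n * q) \<and>
     (\<forall>j<p. \<forall>k<p. \<bar>\<Sum>i<n. \<epsilon> i j * \<epsilon> i k - of_bool (j = k)\<bar> \<le> 13 * real n * q)"

lemma sets_moments_close: "{\<epsilon> \<in> space (noise p n). moments_close p n z q \<epsilon>} \<in> sets (noise p n)"
  unfolding moments_close_def by measurable

text \<open>
  With the exponents \<open>2q\<close> and \<open>q / 4\<close>, the constants \<open>2\<close> and \<open>13\<close> give tails \<open>2 / p\<^sup>2\<close> and \<open>2 / p\<^sup>3\<close>, just
  enough for the union over \<open>p\<close> coordinates and \<open>p\<^sup>2\<close> pairs.  The bound \<open>q \<le> 1\<close> keeps \<open>q / 4\<close> in the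
  range where the moment generating function of a product is finite and sub-Gaussian.
\<close>

lemma moments_close_prob:
  assumes p: "0 < p" and z: "\<And>i. i < n \<Longrightarrow> z i * z i = 1"
    and q: "0 < q" "q \<le> 1" and nq: "n * q\<^sup>2 = ln p"
  shows "1 - 4 / p \<le> measure (noise p n) {\<epsilon> \<in> space (noise p n). moments_close p n z q \<epsilon>}"
proof -
  interpret prob_space "noise p n" by (rule prob_space_noise)
  define A where "A k = {\<epsilon> \<in> space (noise p n). 2 * real n * q \<le> \<bar>\<Sum>i<n. z i * \<epsilon> i k\<bar>}" for k
  define B where "B jk = {\<epsilon> \<in> space (noise p n). 13 * real n * q \<le> \<bar>\<Sum>i<n. \<epsilon> i (fst jk) * \<epsilon> i (snd jk) - of_bool (fst jk = snd jk)\<bar>}" for jk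
  have exp_ln: "exp (- (real m * ln p)) = 1 / p ^ m" for m
    using p by (simp add: exp_minus exp_of_nat_mult inverse_eq_divide)
  have A: "A k \<in> events" "prob (A k) \<le> 2 / p ^ 2" if k: "k < p" for k
  proof -
    show "A k \<in> events" unfolding A_def using k by measurable
    have "prob (A k) \<le> 2 * exp (n * (2 * q\<^sup>2) - 2 * q * (2 * real n * q))"
      unfolding A_def
    proof (rule iid_sum_tail_abs[where g = "\<lambda>i y. z i * y k"])
      show "(\<lambda>y. z i * y k) \<in> borel_measurable (std_gaussian p)" for i using k by measurable
      fix i and \<sigma> :: real assume i: "i < n" and \<sigma>: "\<sigma> \<in> {- 1, 1}"
      have "(\<integral>\<^sup>+ y. ennreal (exp (\<sigma> * (2 * q) * (z i * y k))) \<partial>std_gaussian p)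
          = (\<integral>\<^sup>+ y. ennreal (exp ((\<sigma> * (2 * q) * z i) * y + 0 * y\<^sup>2)) \<partial>density lborel std_normal_density)"
        using nn_integral_std_gaussian_component[OF k, of "\<lambda>y. ennreal (exp (\<sigma> * (2 * q) * (z i * y)))"]
        by (simp add: mult.assoc)
      also have "\<dots> = ennreal (exp (2 * q\<^sup>2))"
        using \<sigma> z[OF i] by (subst nn_integral_exp_quadratic_std_normal) (auto simp: power_mult_distrib power2_eq_square)
      finally show "(\<integral>\<^sup>+ y. ennreal (exp (\<sigma> * (2 * q) * (z i * y k))) \<partial>std_gaussian p) \<le> ennreal (exp (2 * q\<^sup>2))"
        by simp
    qed (use q in auto)
    also have "n * (2 * q\<^sup>2) - 2 * q * (2 * real n * q) = - (real 2 * ln p)"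
      by (simp add: power2_eq_square flip: nq)
    finally show "prob (A k) \<le> 2 / p ^ 2" unfolding exp_ln by simp
  qed
  have B: "B (j, k) \<in> events" "prob (B (j, k)) \<le> 2 / p ^ 3" if jk: "j < p" "k < p" for j k
  proof -
    show "B (j, k) \<in> events" unfolding B_def fst_conv snd_conv using jk by measurable
    have "prob (B (j, k)) \<le> 2 * exp (n * (4 * (q / 4)\<^sup>2) - q / 4 * (13 * real n * q))"
      unfolding B_def fst_conv snd_conv
    proof (rule iid_sum_tail_abs[where g = "\<lambda>i y. y j * y k - of_bool (j = k)"])
      show "(\<lambda>y. y j * y k - of_bool (j = k)) \<in> borel_measurable (std_gaussian p)" using jk by measurable
      fix \<sigma> :: real assume \<sigma>: "\<sigma> \<in> {- 1, 1}"
      have "\<bar>\<sigma> * (q / 4)\<bar> \<le> 1 / 4" "(\<sigma> * (q / 4))\<^sup>2 = (q / 4)\<^sup>2" using \<sigma> q by auto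
      then show "(\<integral>\<^sup>+ y. ennreal (exp (\<sigma> * (q / 4) * (y j * y k - of_bool (j = k)))) \<partial>std_gaussian p) \<le> ennreal (exp (4 * (q / 4)\<^sup>2))"
        using mgf_gaussian_product[OF jk, of "\<sigma> * (q / 4)"] by simp
    qed (use q in auto)
    also have "n * (4 * (q / 4)\<^sup>2) - q / 4 * (13 * real n * q) = - (real 3 * ln p)"
      by (simp add: power2_eq_square field_simps flip: nq)
    finally show "prob (B (j, k)) \<le> 2 / p ^ 3" unfolding exp_ln by simp
  qed
  let ?G = "{\<epsilon> \<in> space (noise p n). moments_close p n z q \<epsilon>}"
  have "prob (space (noise p n) - ?G) \<le> prob ((\<Union>k\<in>{..<p}. A k) \<union> (\<Union>jk\<in>{..<p}\<times>{..<p}. B jk))"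
  proof (rule finite_measure_mono)
    show "space (noise p n) - ?G \<subseteq> (\<Union>k\<in>{..<p}. A k) \<union> (\<Union>jk\<in>{..<p}\<times>{..<p}. B jk)"
      by (force simp: moments_close_def A_def B_def not_le)
    show "(\<Union>k\<in>{..<p}. A k) \<union> (\<Union>jk\<in>{..<p}\<times>{..<p}. B jk) \<in> events"
      using A B by (intro sets.Un sets.finite_UN) auto
  qed
  also have "\<dots> \<le> prob (\<Union>k\<in>{..<p}. A k) + prob (\<Union>jk\<in>{..<p}\<times>{..<p}. B jk)"
    using A B by (intro measure_Un_le sets.finite_UN) auto
  also have "\<dots> \<le> (\<Sum>k<p. prob (A k)) + (\<Sum>jk\<in>{..<p}\<times>{..<p}. prob (B jk))"
    using A B by (intro add_mono measure_UNION_le) auto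
  also have "\<dots> \<le> (\<Sum>k<p. 2 / p ^ 2) + (\<Sum>jk\<in>{..<p}\<times>{..<p}. 2 / p ^ 3)"
    using A B by (intro add_mono sum_mono) auto
  also have "\<dots> = 4 / p"
    using p by (simp add: power2_eq_square power3_eq_cube)
  finally have "1 - prob ?G \<le> 4 / p"
    using prob_compl[OF sets_moments_close[of p n z q]] by simp
  then show ?thesis by simp
qed

section \<open>Measurable leave-one-out near-maximisers\<close>

text \<open>
  A leave-one-out maximiser has to be a measurable function of the data.  Choosing the first member
  of a dense sequence that is optimal up to \<open>\<eta>\<close> achieves this without any selection theorem, and
  continuity transfers the optimality from the sequence to the whole set.
\<close>

lemma countable_dense_sequence:
  fixes V :: "'a :: second_countable_topology set"
  assumes "V \<noteq> {}"
  obtains e :: "nat \<Rightarrow> 'a" where "\<And>k. e k \<in> V"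
    and "\<And>(f :: 'a \<Rightarrow> real) c u. continuous_on UNIV f \<Longrightarrow> (\<And>k. f (e k) \<le> c) \<Longrightarrow> u \<in> V \<Longrightarrow> f u \<le> c"
proof -
  obtain B :: "'a set set" where B: "countable B" "topological_basis B"
    using ex_countable_basis by auto
  define pick where "pick b = (SOME x. x \<in> b \<inter> V)" for b
  define D where "D = pick ` {b \<in> B. b \<inter> V \<noteq> {}}"
  have pick: "pick b \<in> b \<inter> V" if "b \<inter> V \<noteq> {}" for b
    unfolding pick_def by (rule someI_ex) (use that in blast)
  have D: "countable D" "D \<subseteq> V" using B pick by (auto simp: D_def)
  have hit: "\<exists>x\<in>D. x \<in> U" if U: "open U" "u \<in> U" "u \<in> V" for U u
  proof -
    obtain b where "b \<in> B" "u \<in> b" "b \<subseteq> U" using topological_basisE[OF B(2) U(1,2)] by blast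
    then show ?thesis using pick[of b] U(3) by (auto simp: D_def)
  qed
  have "D \<noteq> {}" using hit[of UNIV] assms by auto
  then have range: "range (from_nat_into D) = D" using D(1) by (rule range_from_nat_into)
  show ?thesis
  proof
    show "from_nat_into D k \<in> V" for k using range D(2) by blast
    fix f :: "'a \<Rightarrow> real" and c u
    assume f: "continuous_on UNIV f" "\<And>k. f (from_nat_into D k) \<le> c" and u: "u \<in> V"
    show "f u \<le> c"
    proof (rule ccontr)
      assume "\<not> f u \<le> c"
      moreover have "open {x. c < f x}" using f(1) by (intro open_Collect_less continuous_on_const)
      ultimately obtain x where "x \<in> D" "c < f x" using hit[of "{x. c < f x}" u] u by auto
      then show False using range f(2) by (metis not_le rangeE)
    qed
  qed
qed

text \<open>
  Imposing the alignment with \<open>\<theta>\<close> on the candidates, instead of deriving it for the selected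
  vector, makes it hold for every realisation of the noise.
\<close>

definition aligned_unit :: "nat \<Rightarrow> nat set \<Rightarrow> (nat \<Rightarrow> real) \<Rightarrow> real \<Rightarrow> (nat \<Rightarrow> real) set" where
  "aligned_unit p S \<theta> a = {v. (\<forall>j. j \<notin> S \<longrightarrow> v j = 0) \<and> ip p v v = 1 \<and> a \<le> ip p v \<theta>}"

definition near_argmax :: "real \<Rightarrow> (nat \<Rightarrow> real) \<Rightarrow> nat" where
  "near_argmax \<eta> G = (LEAST k. \<forall>m. G m \<le> G k + \<eta>)"

lemma near_argmax:
  assumes "bdd_above (range G)" "0 < \<eta>"
  shows "G m \<le> G (near_argmax \<eta> G) + \<eta>"
proof -
  have "\<exists>k. Sup (range G) - \<eta> < G k"
    using less_cSupD[of "range G" "Sup (range G) - \<eta>"] assms by auto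
  then obtain k where "Sup (range G) - \<eta> < G k" ..
  moreover have "G m \<le> Sup (range G)" for m using assms(1) by (intro cSup_upper) auto
  ultimately have "\<forall>m. G m \<le> G k + \<eta>" by (smt (verit))
  then have "\<forall>m. G m \<le> G (near_argmax \<eta> G) + \<eta>" unfolding near_argmax_def by (rule LeastI)
  then show ?thesis ..
qed

lemma measurable_near_argmax:
  assumes [measurable]: "\<And>m. (\<lambda>\<omega>. G m \<omega>) \<in> borel_measurable M"
  shows "(\<lambda>\<omega>. near_argmax \<eta> (\<lambda>m. G m \<omega>)) \<in> measurable M (count_space UNIV)"
  unfolding near_argmax_def by measurable

text \<open>
  The two ways in which the leave-one-out comparison can break down for observation \<open>i\<close>: its
  restriction to \<open>S\<close> is too large, or the margin of the leave-one-out direction is at most \<open>t\<close>.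
\<close>

definition loo_fails :: "nat \<Rightarrow> nat \<Rightarrow> (nat \<Rightarrow> real) \<Rightarrow> (nat \<Rightarrow> real) \<Rightarrow> nat set \<Rightarrow> real \<Rightarrow> real \<Rightarrow> real
    \<Rightarrow> (nat \<Rightarrow> nat \<Rightarrow> real) \<Rightarrow> nat \<Rightarrow> (nat \<Rightarrow> nat \<Rightarrow> real) \<Rightarrow> bool" where
  "loo_fails p n z \<theta> S lam \<eta> t e i \<epsilon> \<longleftrightarrow>
     real n * ip p \<theta> \<theta> / 16 < (\<Sum>j\<in>S. (obs z \<theta> \<epsilon> i j)\<^sup>2) \<or>
     z i * ip p (obs z \<theta> \<epsilon> i) (e (near_argmax \<eta> (\<lambda>m. loo_obj p n lam (obs z \<theta> \<epsilon>) i (e m)))) \<le> t"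

lemma measurable_obs[measurable]:
  "i < n \<Longrightarrow> j < p \<Longrightarrow> (\<lambda>\<epsilon>. obs z \<theta> \<epsilon> i j) \<in> borel_measurable (noise p n)"
  unfolding obs_def by measurable

lemma measurable_ip_obs[measurable]:
  "i < n \<Longrightarrow> (\<lambda>\<epsilon>. ip p (obs z \<theta> \<epsilon> i) v) \<in> borel_measurable (noise p n)"
  unfolding ip_def by measurable

lemma measurable_loo_selection:
  assumes i: "i < n"
  shows "(\<lambda>\<epsilon>. ip p (obs z \<theta> \<epsilon> i) (e (near_argmax \<eta> (\<lambda>m. loo_obj p n lam (obs z \<theta> \<epsilon>) i (e m)))))
    \<in> borel_measurable (noise p n)"
proof -
  have "(\<lambda>\<epsilon>. loo_obj p n lam (obs z \<theta> \<epsilon>) i (e m)) \<in> borel_measurable (noise p n)" for m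
    unfolding loo_obj_def by measurable
  then have sel: "(\<lambda>\<epsilon>. near_argmax \<eta> (\<lambda>m. loo_obj p n lam (obs z \<theta> \<epsilon>) i (e m)))
      \<in> measurable (noise p n) (count_space UNIV)"
    by (rule measurable_near_argmax)
  show ?thesis
    by (rule measurable_compose_countable[OF _ sel]) (rule measurable_ip_obs[OF i])
qed

text \<open>
  Given the other observations the selected direction is a fixed unit vector, so its margin is a
  Gaussian variable with mean at least \<open>A\<close> and variance \<open>1\<close>.  The size of the restricted observation
  has a chi-square tail, as \<open>n \<ge> 64\<close> makes the signal part of it negligible.
\<close>

lemma loo_fails_prob:
  fixes lam \<eta> :: real
  assumes i: "i < n" and n: "64 \<le> n" and S: "S \<subseteq> {..<p}"
    and supp: "\<And>j. j \<notin> S \<Longrightarrow> \<theta> j = 0"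
    and z: "z i * z i = 1" and t: "t \<le> A"
    and e: "\<And>k. ip p (e k) (e k) = 1" "\<And>k. A \<le> ip p (e k) \<theta>"
  defines "F \<equiv> {\<epsilon> \<in> space (noise p n). loo_fails p n z \<theta> S lam \<eta> t e i \<epsilon>}"
  shows "F \<in> sets (noise p n)"
    and "measure (noise p n) F \<le> exp (- (real n * ip p \<theta> \<theta> / 256)) * sqrt 2 ^ card S + exp (- (A - t)\<^sup>2 / 2)"
proof -
  interpret prob_space "noise p n" by (rule prob_space_noise)
  interpret G: prob_space "std_gaussian p" by (rule prob_space_std_gaussian)
  define T where "T = ip p \<theta> \<theta>"
  have T0: "0 \<le> T" by (simp add: T_def ip_nonneg)
  define sel where "sel \<epsilon> = near_argmax \<eta> (\<lambda>m. loo_obj p n lam (obs z \<theta> \<epsilon>) i (e m))" for \<epsilon>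
  define F1 where "F1 = {\<epsilon> \<in> space (noise p n). real n * T / 16 < (\<Sum>j\<in>S. (obs z \<theta> \<epsilon> i j)\<^sup>2)}"
  define F2 where "F2 = {\<epsilon> \<in> space (noise p n). z i * ip p (obs z \<theta> \<epsilon> i) (e (sel \<epsilon>)) \<le> t}"
  have finS: "finite S" using S finite_subset by blast
  have F: "F = F1 \<union> F2" by (auto simp: F_def F1_def F2_def loo_fails_def sel_def T_def)
  have obsS: "(\<lambda>\<epsilon>. obs z \<theta> \<epsilon> i j) \<in> borel_measurable (noise p n)" if "j \<in> S" for j
    using that S i by (intro measurable_obs) auto
  have "(\<lambda>\<epsilon>. \<Sum>j\<in>S. (obs z \<theta> \<epsilon> i j)\<^sup>2) \<in> borel_measurable (noise p n)"
    using obsS by (intro borel_measurable_sum borel_measurable_power) auto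
  then have F1: "F1 \<in> events" unfolding F1_def by measurable
  have "(\<lambda>\<epsilon>. ip p (obs z \<theta> \<epsilon> i) (e (sel \<epsilon>))) \<in> borel_measurable (noise p n)"
    unfolding sel_def using i by (rule measurable_loo_selection)
  then have F2: "F2 \<in> events" unfolding F2_def by measurable
  show "F \<in> events" using F F1 F2 by simp
  have p1: "prob F1 \<le> exp (- (real n * T / 256)) * sqrt 2 ^ card S"
    unfolding noise_def
  proof (rule measure_PiM_le_sections[of _ i])
    show "F1 \<in> sets (Pi\<^sub>M {..<n} (\<lambda>_. std_gaussian p))" using F1 by (simp add: noise_def)
    fix x :: "nat \<Rightarrow> nat \<Rightarrow> real"
    have "measure (std_gaussian p) {y \<in> space (std_gaussian p). x(i := y) \<in> F1}
        \<le> measure (std_gaussian p) {y \<in> space (std_gaussian p). real n * T / 64 \<le> (\<Sum>j\<in>S. (y j)\<^sup>2)}"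
    proof (rule G.finite_measure_mono)
      show "{y \<in> space (std_gaussian p). x(i := y) \<in> F1}
        \<subseteq> {y \<in> space (std_gaussian p). real n * T / 64 \<le> (\<Sum>j\<in>S. (y j)\<^sup>2)}"
      proof safe
        fix y assume "x(i := y) \<in> F1"
        then have "real n * T / 16 < (\<Sum>j\<in>S. (z i * \<theta> j + y j)\<^sup>2)" by (simp add: F1_def obs_def)
        also have "\<dots> \<le> (\<Sum>j\<in>S. 2 * (\<theta> j * \<theta> j) + 2 * (y j)\<^sup>2)"
        proof (rule sum_mono)
          fix j
          have "0 \<le> (z i * \<theta> j - y j)\<^sup>2" by simp
          then have "(z i * \<theta> j + y j)\<^sup>2 \<le> 2 * (z i * z i) * (\<theta> j * \<theta> j) + 2 * (y j)\<^sup>2"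
            by (simp add: power2_eq_square algebra_simps)
          then show "(z i * \<theta> j + y j)\<^sup>2 \<le> 2 * (\<theta> j * \<theta> j) + 2 * (y j)\<^sup>2" using z by simp
        qed
        also have "\<dots> = 2 * T + 2 * (\<Sum>j\<in>S. (y j)\<^sup>2)"
        proof -
          have "(\<Sum>j\<in>S. \<theta> j * \<theta> j) = T"
            unfolding T_def ip_def using S supp by (intro sum.mono_neutral_left) auto
          then show ?thesis by (simp add: sum.distrib flip: sum_distrib_left)
        qed
        finally have "real n * T / 16 < 2 * T + 2 * (\<Sum>j\<in>S. (y j)\<^sup>2)" .
        moreover have "64 * T \<le> real n * T" using n T0 by (intro mult_right_mono) auto
        ultimately show "real n * T / 64 \<le> (\<Sum>j\<in>S. (y j)\<^sup>2)" by linarith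
      qed
      have "(\<lambda>y. \<Sum>j\<in>S. (y j)\<^sup>2) \<in> borel_measurable (std_gaussian p)"
        using S by (intro borel_measurable_sum borel_measurable_power measurable_std_gaussian_component) auto
      then show "{y \<in> space (std_gaussian p). real n * T / 64 \<le> (\<Sum>j\<in>S. (y j)\<^sup>2)} \<in> G.events"
        by measurable
    qed
    also have "\<dots> \<le> exp (- (real n * T / 64) / 4) * sqrt 2 ^ card S"
      by (rule gaussian_norm_tail[OF S])
    finally show "measure (std_gaussian p) {y \<in> space (std_gaussian p). x(i := y) \<in> F1}
        \<le> exp (- (real n * T / 256)) * sqrt 2 ^ card S" by simp
  qed (use i in \<open>auto intro: prob_space_std_gaussian\<close>)
  have p2: "prob F2 \<le> exp (- (A - t)\<^sup>2 / 2)"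
    unfolding noise_def
  proof (rule measure_PiM_le_sections[of _ i])
    show "F2 \<in> sets (Pi\<^sub>M {..<n} (\<lambda>_. std_gaussian p))" using F2 by (simp add: noise_def)
    fix x :: "nat \<Rightarrow> nat \<Rightarrow> real"
    \<comment> \<open>leaving out observation \<open>i\<close> makes the selection constant on the section\<close>
    have sel_eq: "sel (x(i := y)) = sel x" for y
      unfolding sel_def using loo_obj_cong[of n i "obs z \<theta> (x(i := y))" "obs z \<theta> x" p lam]
      by (simp add: obs_def fun_eq_iff)
    define v where "v = e (sel x)"
    have "measure (std_gaussian p) {y \<in> space (std_gaussian p). x(i := y) \<in> F2}
        \<le> measure (std_gaussian p) {y \<in> space (std_gaussian p). z i * ip p v y \<le> - (A - t)}"
    proof (rule G.finite_measure_mono)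
      show "{y \<in> space (std_gaussian p). x(i := y) \<in> F2}
        \<subseteq> {y \<in> space (std_gaussian p). z i * ip p v y \<le> - (A - t)}"
      proof safe
        fix y assume "x(i := y) \<in> F2"
        then have "z i * ip p (obs z \<theta> (x(i := y)) i) v \<le> t" by (simp add: F2_def sel_eq v_def)
        moreover have "obs z \<theta> (x(i := y)) i = (\<lambda>j. z i * \<theta> j + y j)"
          by (simp add: obs_def fun_eq_iff)
        ultimately have "z i * (z i * ip p \<theta> v + ip p y v) \<le> t" by (simp only: ip_lin)
        then have "(z i * z i) * ip p v \<theta> + z i * ip p v y \<le> t"
          by (simp add: ip_commute[of p v] algebra_simps)
        then show "z i * ip p v y \<le> - (A - t)" using z e(2)[of "sel x"] by (simp add: v_def)
      qed
      show "{y \<in> space (std_gaussian p). z i * ip p v y \<le> - (A - t)} \<in> G.events"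
        unfolding ip_def by measurable
    qed
    also have "\<dots> \<le> exp (- (A - t)\<^sup>2 / 2)"
      using e(1) z t by (intro gaussian_projection_tail) (auto simp: v_def power2_eq_square)
    finally show "measure (std_gaussian p) {y \<in> space (std_gaussian p). x(i := y) \<in> F2}
        \<le> exp (- (A - t)\<^sup>2 / 2)" .
  qed (use i in \<open>auto intro: prob_space_std_gaussian\<close>)
  show "prob F \<le> exp (- (real n * ip p \<theta> \<theta> / 256)) * sqrt 2 ^ card S + exp (- (A - t)\<^sup>2 / 2)"
    using measure_Un_le[OF F1 F2] p1 p2 by (simp add: F T_def)
qed

section \<open>From matrices to functions\<close>

lemma scalar_prod_eq_ip:
  "v \<in> carrier_vec p \<Longrightarrow> w \<in> carrier_vec p \<Longrightarrow> v \<bullet> w = ip p (\<lambda>j. v $ j) (\<lambda>j. w $ j)"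
  by (simp add: scalar_prod_def ip_def lessThan_atLeast0)

lemma mult_mat_vec_index:
  "P \<in> carrier_mat m p \<Longrightarrow> v \<in> carrier_vec p \<Longrightarrow> j < m \<Longrightarrow> (P *\<^sub>v v) $ j = (\<Sum>k<p. P $$ (j, k) * v $ k)"
  by (auto simp: scalar_prod_def lessThan_atLeast0 intro!: sum.cong)

lemma quadratic_form_eq_bil:
  assumes "P \<in> carrier_mat p p" "v \<in> carrier_vec p"
  shows "v \<bullet> (P *\<^sub>v v) = bil p (\<lambda>j k. P $$ (j, k)) (\<lambda>j. v $ j) (\<lambda>j. v $ j)"
proof -
  have "P *\<^sub>v v \<in> carrier_vec p" using assms by auto
  then have "v \<bullet> (P *\<^sub>v v) = (\<Sum>j<p. v $ j * (P *\<^sub>v v) $ j)"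
    using assms by (simp add: scalar_prod_eq_ip ip_def)
  also have "\<dots> = bil p (\<lambda>j k. P $$ (j, k)) (\<lambda>j. v $ j) (\<lambda>j. v $ j)"
    unfolding bil_def using mult_mat_vec_index[OF assms]
    by (intro sum.cong refl) (simp add: sum_distrib_left mult.assoc)
  finally show ?thesis .
qed

lemma fantope1_psd:
  assumes "P \<in> fantope1 p"
  shows "psd p (\<lambda>j k. P $$ (j, k))" "trc p (\<lambda>j k. P $$ (j, k)) = 1"
proof -
  have P: "P \<in> carrier_mat p p" "transpose_mat P = P" "mat_tr P = 1" "loewner_le (0\<^sub>m p p) P"
    using assms by (auto simp: fantope1_def)
  show "trc p (\<lambda>j k. P $$ (j, k)) = 1" using P by (auto simp: trc_def mat_tr_def)
  have "P $$ (j, k) = P $$ (k, j)" if "j < p" "k < p" for j k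
    using P(1) that index_transpose_mat(1)[of j P k] by (simp add: P(2))
  moreover have "0 \<le> bil p (\<lambda>j k. P $$ (j, k)) x x" for x
  proof -
    have "P - 0\<^sub>m p p = P" using P(1) by (intro eq_matI) auto
    then have "0 \<le> Matrix.vec p x \<bullet> (P *\<^sub>v Matrix.vec p x)"
      using P(4) by (simp add: loewner_le_def)
    also have "\<dots> = bil p (\<lambda>j k. P $$ (j, k)) x x"
      using P(1) by (subst quadratic_form_eq_bil) (auto intro!: bil_cong)
    finally show ?thesis .
  qed
  ultimately show "psd p (\<lambda>j k. P $$ (j, k))" by (simp add: psd_def)
qed

lemma psd_fantope1:
  assumes "psd p Q" "trc p Q = 1"
  shows "Matrix.mat p p (\<lambda>(j, k). Q j k) \<in> fantope1 p" (is "?Q \<in> _")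
proof -
  have Q: "?Q \<in> carrier_mat p p" by simp
  have q: "v \<bullet> (?Q *\<^sub>v v) = bil p Q (\<lambda>j. v $ j) (\<lambda>j. v $ j)" if "v \<in> carrier_vec p" for v
    using quadratic_form_eq_bil[OF Q that] by (auto intro!: bil_cong)
  have "transpose_mat ?Q = ?Q" using psd_sym[OF assms(1)] by (intro eq_matI) auto
  moreover have "mat_tr ?Q = 1" using assms(2) by (simp add: mat_tr_def trc_def)
  moreover have "?Q - 0\<^sub>m p p = ?Q" by (intro eq_matI) auto
  then have "loewner_le (0\<^sub>m p p) ?Q"
    using q psd_nonneg[OF assms(1)] by (simp add: loewner_le_def)
  moreover have "loewner_le ?Q (1\<^sub>m p)"
    unfolding loewner_le_def
  proof (intro ballI)
    fix v :: "real vec" assume "v \<in> carrier_vec (dim_row ?Q)"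
    then have v: "v \<in> carrier_vec p" by simp
    have "v \<bullet> ((1\<^sub>m p - ?Q) *\<^sub>v v) = v \<bullet> v - v \<bullet> (?Q *\<^sub>v v)"
      using v minus_mult_distrib_mat_vec[OF one_carrier_mat Q v]
        scalar_prod_minus_distrib[OF v v mult_mat_vec_carrier[OF Q v]] by simp
    also have "\<dots> = ip p (\<lambda>j. v $ j) (\<lambda>j. v $ j) - bil p Q (\<lambda>j. v $ j) (\<lambda>j. v $ j)"
      using v q by (simp add: scalar_prod_eq_ip)
    also have "\<dots> \<ge> 0" using psd_le_trc[OF assms(1), of "\<lambda>j. v $ j"] assms(2) by simp
    finally show "0 \<le> v \<bullet> ((1\<^sub>m p - ?Q) *\<^sub>v v)" by simp
  qed
  ultimately show ?thesis by (simp add: fantope1_def)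
qed

lemma penalised_objective_eq:
  assumes X: "X \<in> carrier_mat p n" and Y: "\<And>i j. i < n \<Longrightarrow> j < p \<Longrightarrow> X $$ (j, i) = Y i j"
    and Q: "Q \<in> carrier_mat p p"
  shows "mat_inner ((1 / real (dim_col X)) \<cdot>\<^sub>m (X * transpose_mat X)) Q - lam * mat_norm_1 Q
    = penobj p (gram n Y) lam (\<lambda>j k. Q $$ (j, k))"
proof -
  let ?M = "(1 / real (dim_col X)) \<cdot>\<^sub>m (X * transpose_mat X)"
  have M: "?M \<in> carrier_mat p p" using X by auto
  have entry: "?M $$ (j, k) = gram n Y j k" if "j < p" "k < p" for j k
    using X that by (simp add: gram_def scalar_prod_def Y lessThan_atLeast0)
  have "mat_inner ?M Q = (\<Sum>k<p. \<Sum>j<p. ?M $$ (j, k) * Q $$ (j, k))"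
    unfolding mat_inner_def mat_tr_def using M Q
    by (auto simp: scalar_prod_def lessThan_atLeast0 intro!: sum.cong)
  also have "\<dots> = (\<Sum>j<p. \<Sum>k<p. ?M $$ (j, k) * Q $$ (j, k))" by (rule sum.swap)
  also have "\<dots> = frob p (gram n Y) (\<lambda>j k. Q $$ (j, k))"
    unfolding frob_def by (intro sum.cong refl) (simp add: entry del: index_smult_mat)
  finally show ?thesis using Q by (simp add: penobj_def l1_def mat_norm_1_def)
qed

lemma arg_max_pen_max:
  assumes X: "X \<in> carrier_mat p n" and Y: "\<And>i j. i < n \<Longrightarrow> j < p \<Longrightarrow> X $$ (j, i) = Y i j"
    and max: "is_arg_max (\<lambda>Q. mat_inner ((1 / real (dim_col X)) \<cdot>\<^sub>m (X * transpose_mat X)) Q - lam * mat_norm_1 Q)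
       (\<lambda>Q. Q \<in> fantope1 (dim_row X)) P"
  shows "P \<in> carrier_mat p p" "pen_max p (gram n Y) lam (\<lambda>j k. P $$ (j, k))"
proof -
  have P: "P \<in> fantope1 p" using max X by (auto simp: is_arg_max_def)
  then show Pc: "P \<in> carrier_mat p p" by (simp add: fantope1_def)
  note obj = penalised_objective_eq[OF X Y]
  have "penobj p (gram n Y) lam Q \<le> penobj p (gram n Y) lam (\<lambda>j k. P $$ (j, k))"
    if Q: "psd p Q" "trc p Q = 1" for Q
  proof -
    let ?Q = "Matrix.mat p p (\<lambda>(j, k). Q j k)"
    have "penobj p (gram n Y) lam (\<lambda>j k. ?Q $$ (j, k)) \<le> penobj p (gram n Y) lam (\<lambda>j k. P $$ (j, k))"
      using max psd_fantope1[OF Q] X obj[OF _ _ Pc] obj[of ?Q] unfolding is_arg_max_def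
      by (auto simp: not_less)
    moreover have "penobj p (gram n Y) lam (\<lambda>j k. ?Q $$ (j, k)) = penobj p (gram n Y) lam Q"
      by (simp add: penobj_def frob_def l1_def)
    ultimately show ?thesis by simp
  qed
  then show "pen_max p (gram n Y) lam (\<lambda>j k. P $$ (j, k))"
    using fantope1_psd[OF P] by (simp add: pen_max_def)
qed

text \<open>
  The algorithm in terms of coordinate functions, with \<open>Y i j\<close> for entry \<open>j\<close> of observation \<open>i\<close>.
\<close>

lemma ssc_outputE:
  assumes out: "ssc_output lam X zh" and X: "X \<in> carrier_mat p n"
    and Y: "\<And>i j. i < n \<Longrightarrow> j < p \<Longrightarrow> X $$ (j, i) = Y i j"
  obtains P u k where "pen_max p (gram n Y) lam P" "ip p u u = 1" "\<And>j. p \<le> j \<Longrightarrow> u j = 0"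
    "\<And>j. j < p \<Longrightarrow> (\<Sum>l<p. P j l * u l) = k * u j"
    "\<And>k' v. (\<And>j. j < p \<Longrightarrow> (\<Sum>l<p. P j l * v l) = k' * v j) \<Longrightarrow> ip p v v \<noteq> 0 \<Longrightarrow> k' \<le> k"
    "\<And>i. i < n \<Longrightarrow> zh $ i = sgn_pm (ip p (Y i) u)"
proof -
  obtain A w where
    max: "is_arg_max (\<lambda>Q. mat_inner ((1 / real (dim_col X)) \<cdot>\<^sub>m (X * transpose_mat X)) Q - lam * mat_norm_1 Q)
       (\<lambda>Q. Q \<in> fantope1 (dim_row X)) A"
    and lead: "leading_unit_eigenvector A w"
    and zh: "zh = map_vec sgn_pm (transpose_mat X *\<^sub>v w)"
    using out unfolding ssc_output_def by blast
  note A = arg_max_pen_max[OF X Y max]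
  obtain k where k: "eigenvector A w k" "\<And>k'. eigenvalue A k' \<Longrightarrow> k' \<le> k"
    using lead by (auto simp: leading_unit_eigenvector_def)
  have w: "w \<in> carrier_vec p" "A *\<^sub>v w = k \<cdot>\<^sub>v w" using k(1) A(1) by (auto simp: eigenvector_def)
  define u where "u = (\<lambda>j. if j < p then w $ j else 0)"
  show ?thesis
  proof (rule that[of "\<lambda>j k. A $$ (j, k)" u k])
    show "pen_max p (gram n Y) lam (\<lambda>j k. A $$ (j, k))" by (rule A(2))
    show "ip p u u = 1"
      using lead w(1) by (simp add: leading_unit_eigenvector_def vnorm_def scalar_prod_eq_ip)
        (simp add: ip_def u_def)
    show "u j = 0" if "p \<le> j" for j using that by (simp add: u_def)
    show "(\<Sum>l<p. A $$ (j, l) * u l) = k * u j" if "j < p" for j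
      using mult_mat_vec_index[OF A(1) w(1) that] w that by (simp add: u_def)
    show "k' \<le> k" if v: "\<And>j. j < p \<Longrightarrow> (\<Sum>l<p. A $$ (j, l) * v l) = k' * v j" "ip p v v \<noteq> 0" for k' v
    proof (rule k(2))
      have "A *\<^sub>v Matrix.vec p v = k' \<cdot>\<^sub>v Matrix.vec p v"
      proof (rule eq_vecI)
        fix j assume "j < dim_vec (k' \<cdot>\<^sub>v Matrix.vec p v)"
        then have j: "j < p" by simp
        show "(A *\<^sub>v Matrix.vec p v) $ j = (k' \<cdot>\<^sub>v Matrix.vec p v) $ j"
          using mult_mat_vec_index[OF A(1), of "Matrix.vec p v" j] v(1)[OF j] j by simp
      qed (use A(1) in auto)
      moreover have "Matrix.vec p v \<noteq> 0\<^sub>v p"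
      proof
        assume eq: "Matrix.vec p v = 0\<^sub>v p"
        have "v j = 0" if "j < p" for j
          using arg_cong[OF eq, of "\<lambda>x. x $ j"] that by simp
        then show False using v(2) by (simp add: ip_def)
      qed
      ultimately show "eigenvalue A k'"
        unfolding eigenvalue_def eigenvector_def using A(1)
        by (intro exI[of _ "Matrix.vec p v"]) auto
    qed
    show "zh $ i = sgn_pm (ip p (Y i) u)" if "i < n" for i
    proof -
      have "(transpose_mat X *\<^sub>v w) $ i = (\<Sum>j<p. transpose_mat X $$ (i, j) * w $ j)"
        using X w(1) that by (intro mult_mat_vec_index) auto
      also have "\<dots> = ip p (Y i) u" using X Y that by (simp add: ip_def u_def)
      finally show ?thesis using zh X w(1) that by simp
    qed
  qed
qed

section \<open>The misclassification rate\<close>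

text \<open>
  The sign \<open>\<sigma>\<close> resolves the ambiguity of the leading eigenvector: \<open>\<sigma> u\<close> is the one that points
  towards \<open>\<theta>\<close>, and it is compared with the leave-one-out near-maximiser.
\<close>

lemma correct_unless_loo_fails:
  assumes spiked: "spiked p S \<theta> (gram n (obs z \<theta> \<epsilon>)) lam h T"
    and n: "0 < n" and \<eta>: "0 < \<eta>"
    and z: "\<And>i. i < n \<Longrightarrow> z i \<in> {- 1, 1}"
    and eV: "\<And>k. e k \<in> aligned_unit p S \<theta> ((1 - 3/2 * h) * sqrt T)"
    and dense: "\<And>f c u. continuous_on UNIV f \<Longrightarrow> (\<And>k. f (e k) \<le> c) \<Longrightarrow> u \<in> aligned_unit p S \<theta> ((1 - 3/2 * h) * sqrt T) \<Longrightarrow> f u \<le> (c :: real)"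
    and P: "pen_max p (gram n (obs z \<theta> \<epsilon>)) lam P" and u1: "ip p u u = 1" and u0: "\<And>j. p \<le> j \<Longrightarrow> u j = 0"
    and eig: "\<And>j. j < p \<Longrightarrow> (\<Sum>l<p. P j l * u l) = k * u j"
    and lead: "\<And>k' v. (\<And>j. j < p \<Longrightarrow> (\<Sum>l<p. P j l * v l) = k' * v j) \<Longrightarrow> ip p v v \<noteq> 0 \<Longrightarrow> k' \<le> k"
  shows "\<exists>\<sigma> \<in> {- 1, 1}. \<forall>i<n. \<not> loo_fails p n z \<theta> S lam \<eta> (sqrt (real n * \<eta>)) e i \<epsilon> \<longrightarrow>
           \<sigma> * sgn_pm (ip p (obs z \<theta> \<epsilon> i) u) = z i"
proof -
  interpret spiked p S \<theta> "gram n (obs z \<theta> \<epsilon>)" lam h T by (rule spiked)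
  let ?M = "gram n (obs z \<theta> \<epsilon>)"
  have P_eq: "P j l = u j * u l" if "j < p" "l < p" for j l
    using P u1 eig lead that by (rule pen_max_rank_one)
  define \<sigma> where "\<sigma> = (if 0 \<le> ip p u \<theta> then 1 else - 1 :: real)"
  define w where "w = (\<lambda>j. \<sigma> * u j)"
  have \<sigma>: "\<sigma> \<in> {- 1, 1}" "\<sigma> * \<sigma> = 1" by (auto simp: \<sigma>_def)
  have w1: "ip p w w = 1" unfolding w_def ip_lin using u1 \<sigma>(2) by simp
  have suppw: "\<forall>j. j \<notin> S \<longrightarrow> w j = 0"
  proof (intro allI impI)
    fix j assume j: "j \<notin> S"
    show "w j = 0"
    proof (cases "j < p")
      case True
      then have "P j j = 0" using pen_max_supported[OF P] j by (auto simp: supp_in_def)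
      then show ?thesis using P_eq[OF True True] by (simp add: w_def)
    qed (use u0 w_def in auto)
  qed
  have w\<theta>: "(1 - 3/2 * h) * sqrt T \<le> ip p w \<theta>"
  proof -
    have "bil p P \<theta> \<theta> = bil p (rank_one 1 u) \<theta> \<theta>" by (rule bil_cong) (simp_all add: P_eq rank_one_def)
    then have "T * (1 - 3/2 * h) \<le> (ip p u \<theta>)\<^sup>2"
      using pen_max_alignment[OF P] by (simp add: bil_rank_one power2_eq_square)
    moreover have "(ip p u \<theta>)\<^sup>2 = (ip p w \<theta>)\<^sup>2"
      using \<sigma>(2) by (simp add: w_def ip_lin power_mult_distrib power2_eq_square[of \<sigma>])
    moreover have "((1 - 3/2 * h) * sqrt T)\<^sup>2 \<le> T * (1 - 3/2 * h)"
    proof -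
      have "(1 - 3/2 * h)\<^sup>2 \<le> 1 - 3/2 * h"
        using h h_nonneg mult_left_le[of "1 - 3/2 * h" "1 - 3/2 * h"] by (simp add: power2_eq_square)
      then have "T * (1 - 3/2 * h)\<^sup>2 \<le> T * (1 - 3/2 * h)" using T_pos by (intro mult_left_mono) auto
      then show ?thesis using T_pos by (simp add: power_mult_distrib mult.commute)
    qed
    ultimately have "((1 - 3/2 * h) * sqrt T)\<^sup>2 \<le> (ip p w \<theta>)\<^sup>2" by linarith
    moreover have "0 \<le> ip p w \<theta>" by (simp add: w_def ip_lin \<sigma>_def)
    ultimately show ?thesis by (rule power2_le_imp_le)
  qed
  have max: "pen_max p ?M lam (rank_one 1 w)"
  proof -
    have "penobj p ?M lam (rank_one 1 w) = penobj p ?M lam P"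
    proof (rule penobj_cong)
      fix j k assume "j < p" "k < p"
      moreover have "rank_one 1 w j k = (\<sigma> * \<sigma>) * (u j * u k)" by (simp add: rank_one_def w_def)
      ultimately show "rank_one 1 w j k = P j k" using \<sigma>(2) by (simp add: P_eq)
    qed
    then show ?thesis using P w1 psd_rank_one[of 1 p w] by (simp add: pen_max_def trc_rank_one)
  qed
  have "\<sigma> * sgn_pm (ip p (obs z \<theta> \<epsilon> i) u) = z i"
    if i: "i < n" and ok: "\<not> loo_fails p n z \<theta> S lam \<eta> (sqrt (real n * \<eta>)) e i \<epsilon>" for i
  proof -
    define G where "G = (\<lambda>m. loo_obj p n lam (obs z \<theta> \<epsilon>) i (e m))"
    define v where "v = e (near_argmax \<eta> G)"
    have v: "\<forall>j. j \<notin> S \<longrightarrow> v j = 0" "ip p v v = 1" "(1 - 3/2 * h) * sqrt T \<le> ip p v \<theta>"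
      using eV[of "near_argmax \<eta> G"] by (auto simp: v_def aligned_unit_def)
    have "bdd_above (range G)"
      unfolding G_def using eV lam by (intro bdd_aboveI2[OF loo_obj_bounded]) (auto simp: aligned_unit_def)
    from near_argmax[OF this \<eta>] have le: "loo_obj p n lam (obs z \<theta> \<epsilon>) i (e m)
        \<le> loo_obj p n lam (obs z \<theta> \<epsilon>) i v + \<eta>" for m
      by (simp add: G_def v_def)
    have "w \<in> aligned_unit p S \<theta> ((1 - 3/2 * h) * sqrt T)"
      using suppw w1 w\<theta> by (simp add: aligned_unit_def)
    from dense[OF continuous_on_loo_obj le this]
    have "loo_obj p n lam (obs z \<theta> \<epsilon>) i w \<le> loo_obj p n lam (obs z \<theta> \<epsilon>) i v + \<eta>" .
    then have near: "penobj p ?M lam (rank_one 1 w) - (ip p (obs z \<theta> \<epsilon> i) w)\<^sup>2 / real n - \<eta>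
        \<le> penobj p ?M lam (rank_one 1 v) - (ip p (obs z \<theta> \<epsilon> i) v)\<^sup>2 / real n"
      using loo_obj_eq[OF i, of p lam "obs z \<theta> \<epsilon>"] by simp
    have "0 < z i * ip p (obs z \<theta> \<epsilon> i) w"
      using ok z[OF i] n \<eta>
      by (intro leave_one_out_sign[OF max w1 v(2) suppw v(1) w\<theta> v(3) _ _ near])
        (auto simp: loo_fails_def v_def G_def T_def not_less not_le)
    moreover have "ip p (obs z \<theta> \<epsilon> i) w = \<sigma> * ip p (obs z \<theta> \<epsilon> i) u" by (simp add: w_def ip_lin)
    ultimately show ?thesis using z[OF i] \<sigma>(1) by (auto simp: sgn_pm_def)
  qed
  then show ?thesis using \<sigma>(1) by blast
qed

lemma clustering_loss_le:
  assumes "\<sigma> \<in> {- 1, 1}"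
  shows "clustering_loss zh z \<le> (\<Sum>i<dim_vec z. of_bool (\<sigma> * zh $ i \<noteq> z $ i)) / real (dim_vec z)"
proof -
  have "clustering_loss zh z \<le> 1 / real (dim_vec z) * (\<Sum>i<dim_vec z. of_bool (\<sigma> * zh $ i \<noteq> z $ i))"
    unfolding clustering_loss_def using assms by (intro Min_le) auto
  then show ?thesis by simp
qed

lemma clustering_loss_le_1: "clustering_loss zh z \<le> 1"
proof -
  have "(\<Sum>i<dim_vec z. of_bool (1 * zh $ i \<noteq> z $ i) :: real) \<le> (\<Sum>i<dim_vec z. 1)"
    by (intro sum_mono) auto
  then have "(\<Sum>i<dim_vec z. of_bool (1 * zh $ i \<noteq> z $ i)) / real (dim_vec z) \<le> 1"
    by (auto simp: divide_le_eq_1)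
  moreover have "clustering_loss zh z \<le> (\<Sum>i<dim_vec z. of_bool (1 * zh $ i \<noteq> z $ i)) / real (dim_vec z)"
    by (rule clustering_loss_le) simp
  ultimately show ?thesis by linarith
qed

text \<open>
  Here \<open>L\<close> is \<open>log p\<close> and \<open>k\<close> the size of the support.  As \<open>T \<le> k \<kappa>\<^sup>2\<close> and \<open>\<kappa>\<^sup>2 \<le> L\<close>, a small \<open>\<tau>\<close> forces
  \<open>n \<ge> 1 / \<tau>\<^sup>2\<close>; so the sample is large even though only \<open>log p \<le> n\<close> is assumed.
\<close>

lemma signal_strength_consequences:
  fixes L n s k T \<kappa> C \<tau> :: real
  assumes L: "1 \<le> L" "L \<le> n" and \<kappa>: "0 < \<kappa>" "\<kappa>\<^sup>2 \<le> L" and T: "1 < T" "T \<le> k * \<kappa>\<^sup>2"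
    and k: "0 \<le> k" "k \<le> s" and \<tau>: "0 \<le> \<tau>" "\<tau>\<^sup>2 = s\<^sup>2 * L * (1 + \<kappa>\<^sup>2) / (n * T\<^sup>2)"
    and C: "26 \<le> C" "1000 * C * \<tau> < 1"
  shows "0 < \<tau>" "256 \<le> n" "k \<le> \<tau> * (n * T)"
    "C * (1 + \<kappa>) * sqrt (L / n) * k \<le> 2 * C * \<tau> * T"
proof -
  have npos: "0 < n" using L by simp
  have \<tau>2: "\<tau>\<^sup>2 * n * T\<^sup>2 = s\<^sup>2 * L * (1 + \<kappa>\<^sup>2)"
    using T npos by (simp add: \<tau>(2))
  have s0: "0 \<le> s" using k by simp
  have "T\<^sup>2 \<le> (s * \<kappa>\<^sup>2)\<^sup>2"
  proof (intro power_mono)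
    show "T \<le> s * \<kappa>\<^sup>2" using T(2) mult_right_mono[OF k(2), of "\<kappa>\<^sup>2"] by simp
  qed (use T in simp)
  also have "(s * \<kappa>\<^sup>2)\<^sup>2 = s\<^sup>2 * (\<kappa>\<^sup>2 * \<kappa>\<^sup>2)" by (simp add: power2_eq_square mult_ac)
  also have "\<dots> \<le> s\<^sup>2 * (L * (1 + \<kappa>\<^sup>2))"
    using \<kappa> L by (intro mult_left_mono mult_mono) auto
  also have "\<dots> = \<tau>\<^sup>2 * n * T\<^sup>2" using \<tau>2 by (simp add: mult.assoc)
  finally have "1 * T\<^sup>2 \<le> (\<tau>\<^sup>2 * n) * T\<^sup>2" by simp
  moreover have "0 < T\<^sup>2" using T by simp
  ultimately have \<tau>n: "1 \<le> \<tau>\<^sup>2 * n" by (rule mult_right_le_imp_le)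
  then have "\<tau> \<noteq> 0" by auto
  then show "0 < \<tau>" using \<tau>(1) by simp
  have "26 * \<tau> \<le> C * \<tau>" using C(1) \<tau>(1) by (rule mult_right_mono)
  then have \<tau>_small: "\<tau> \<le> 1/16" using C(2) by linarith
  have "\<tau>\<^sup>2 \<le> (1/16)\<^sup>2" using \<tau>_small \<tau>(1) by (rule power_mono)
  then have "\<tau>\<^sup>2 * n \<le> (1/16)\<^sup>2 * n" using npos by (intro mult_right_mono) auto
  then show n256: "256 \<le> n" using \<tau>n by (simp add: power2_eq_square)
  have "s\<^sup>2 * 1 \<le> s\<^sup>2 * (L * (1 + \<kappa>\<^sup>2))"
    using L mult_mono[of 1 L 1 "1 + \<kappa>\<^sup>2"] by (intro mult_left_mono) auto
  also have "\<dots> = (\<tau>\<^sup>2 * T\<^sup>2) * n" using \<tau>2 by (simp add: mult_ac)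
  also have "\<dots> \<le> (\<tau>\<^sup>2 * T\<^sup>2) * (n * n)"
    using n256 mult_right_mono[of 1 n n] by (intro mult_left_mono) auto
  also have "\<dots> = (\<tau> * (n * T))\<^sup>2" by (simp add: power2_eq_square mult_ac)
  finally have "s\<^sup>2 \<le> (\<tau> * (n * T))\<^sup>2" by simp
  then have "s \<le> \<tau> * (n * T)" by (rule power2_le_imp_le) (use \<tau> npos T in simp)
  then show "k \<le> \<tau> * (n * T)" using k by simp
  have "C * (1 + \<kappa>) * sqrt (L / n) * k \<le> C * (1 + \<kappa>) * sqrt (L / n) * s"
    using C \<kappa> L k by (intro mult_left_mono) auto
  also have "\<dots> \<le> 2 * C * \<tau> * T"
  proof (rule power2_le_imp_le)
    have "(1 + \<kappa>)\<^sup>2 \<le> 4 * (1 + \<kappa>\<^sup>2)"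
    proof -
      have "0 \<le> (1 - \<kappa>)\<^sup>2" by simp
      then have "2 * \<kappa> \<le> 1 + \<kappa>\<^sup>2" by (simp add: power2_diff)
      moreover have "(1 + \<kappa>)\<^sup>2 = 1 + 2 * \<kappa> + \<kappa>\<^sup>2" by (simp add: power2_sum)
      moreover have "0 \<le> \<kappa>\<^sup>2" by simp
      ultimately show ?thesis by argo
    qed
    have "(C * (1 + \<kappa>) * sqrt (L / n) * s)\<^sup>2 = C\<^sup>2 * (1 + \<kappa>)\<^sup>2 * (L / n) * s\<^sup>2"
      using L npos by (simp add: power_mult_distrib)
    also have "\<dots> \<le> C\<^sup>2 * (4 * (1 + \<kappa>\<^sup>2)) * (L / n) * s\<^sup>2"
      using \<open>(1 + \<kappa>)\<^sup>2 \<le> 4 * (1 + \<kappa>\<^sup>2)\<close> L npos by (intro mult_right_mono mult_left_mono) auto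
    also have "\<dots> = 4 * C\<^sup>2 * (s\<^sup>2 * L * (1 + \<kappa>\<^sup>2)) / n" by simp
    also have "\<dots> = (2 * C * \<tau> * T)\<^sup>2"
      unfolding \<tau>2[symmetric] using npos by (simp add: power_mult_distrib)
    finally show "(C * (1 + \<kappa>) * sqrt (L / n) * s)\<^sup>2 \<le> (2 * C * \<tau> * T)\<^sup>2" .
  qed (use C \<tau> T in simp)
  finally show "C * (1 + \<kappa>) * sqrt (L / n) * k \<le> 2 * C * \<tau> * T" .
qed

text \<open>
  The norm of the restricted observation contributes \<open>exp (- n T / 256)\<close> against at most
  \<open>exp (k / 2)\<close>, which beats \<open>exp (- T / 2)\<close> because \<open>n\<close> is large and \<open>k\<close> is small against \<open>n T\<close>.
  The margin contributes the Gaussian tail at \<open>(1 - 3 C \<tau> - \<tau>) sqrt T\<close>.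
\<close>

lemma error_rate_bound:
  fixes n T C \<tau> :: real
  assumes n: "256 \<le> n" and T: "0 < T" and \<tau>: "0 \<le> \<tau>" and C: "26 \<le> C" "1000 * C * \<tau> < 1"
    and k: "real k \<le> \<tau> * (n * T)"
  shows "\<tau> * sqrt T \<le> (1 - 3 / 2 * (2 * C * \<tau>)) * sqrt T"
    and "exp (- (n * T / 256)) * sqrt 2 ^ k + exp (- ((1 - 3 / 2 * (2 * C * \<tau>)) * sqrt T - \<tau> * sqrt T)\<^sup>2 / 2)
      \<le> 2 * exp (- (T / 2) * (1 - 1000 * C * \<tau>))"
proof -
  have C\<tau>: "26 * \<tau> \<le> C * \<tau>" using C(1) \<tau> by (rule mult_right_mono)
  define \<beta> where "\<beta> = 1 - 3 * C * \<tau> - \<tau>"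
  have \<beta>: "0 \<le> \<beta>" using C\<tau> C(2) unfolding \<beta>_def by linarith
  have "\<tau> \<le> 1 - 3 / 2 * (2 * C * \<tau>)" using \<beta> by (simp add: \<beta>_def)
  then show "\<tau> * sqrt T \<le> (1 - 3 / 2 * (2 * C * \<tau>)) * sqrt T" using T by (intro mult_right_mono) auto
  have "exp (- (n * T / 256)) * sqrt 2 ^ k \<le> exp (- (T / 2) * (1 - 1000 * C * \<tau>))"
  proof -
    have "sqrt 2 \<le> exp (1 / 2 :: real)"
    proof (rule real_le_lsqrt)
      \<comment> \<open>that is, \<open>2 \<le> exp 1\<close>\<close>
      show "(2 :: real) \<le> (exp (1 / 2))\<^sup>2"
        using exp_ge_add_one_self[of "1 :: real"] by (simp add: power2_eq_square flip: exp_add)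
    qed auto
    then have "sqrt 2 ^ k \<le> exp (1 / 2 :: real) ^ k" by (intro power_mono) auto
    also have "\<dots> = exp (real k / 2)" by (simp flip: exp_of_nat_mult)
    finally have "exp (- (n * T / 256)) * sqrt 2 ^ k \<le> exp (- (n * T / 256)) * exp (real k / 2)"
      by (intro mult_left_mono) auto
    also have "\<dots> = exp (real k / 2 - n * T / 256)" by (simp flip: exp_add)
    also have "\<dots> \<le> exp (- (T / 2) * (1 - 1000 * C * \<tau>))"
    proof (intro exp_le_cancel_iff[THEN iffD2])
      have nT: "256 * T \<le> n * T" using n T by (intro mult_right_mono) auto
      have "\<tau> \<le> 1 / 256" using C\<tau> C(2) by linarith
      then have "\<tau> * (n * T) \<le> 1 / 256 * (n * T)" using n T by (intro mult_right_mono) auto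
      then have "real k / 2 - n * T / 256 \<le> - (T / 2)" using nT k by linarith
      also have "\<dots> \<le> - (T / 2) * (1 - 1000 * C * \<tau>)" using T C \<tau> by (simp add: algebra_simps)
      finally show "real k / 2 - n * T / 256 \<le> - (T / 2) * (1 - 1000 * C * \<tau>)" .
    qed
    finally show ?thesis .
  qed
  moreover have "exp (- ((1 - 3 / 2 * (2 * C * \<tau>)) * sqrt T - \<tau> * sqrt T)\<^sup>2 / 2) \<le> exp (- (T / 2) * (1 - 1000 * C * \<tau>))"
  proof (intro exp_le_cancel_iff[THEN iffD2])
    have "((1 - 3 / 2 * (2 * C * \<tau>)) * sqrt T - \<tau> * sqrt T) = \<beta> * sqrt T"
      by (simp add: \<beta>_def algebra_simps)
    then have sq: "((1 - 3 / 2 * (2 * C * \<tau>)) * sqrt T - \<tau> * sqrt T)\<^sup>2 = T * \<beta>\<^sup>2"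
      using T by (simp add: power_mult_distrib)
    have "0 \<le> (1 - \<beta>)\<^sup>2" by simp
    then have "2 * \<beta> - 1 \<le> \<beta>\<^sup>2" by (simp add: power2_eq_square algebra_simps)
    moreover have "1 - 1000 * C * \<tau> \<le> 2 * \<beta> - 1"
    proof -
      have "\<beta> = 1 - 3 * (C * \<tau>) - \<tau>" "1000 * C * \<tau> = 1000 * (C * \<tau>)" by (simp_all add: \<beta>_def)
      then show ?thesis using C\<tau> \<tau> by linarith
    qed
    ultimately have "1 - 1000 * C * \<tau> \<le> \<beta>\<^sup>2" by (rule order.trans[rotated])
    then have "T * (1 - 1000 * C * \<tau>) \<le> T * \<beta>\<^sup>2" using T by (intro mult_left_mono) auto
    then show "- ((1 - 3 / 2 * (2 * C * \<tau>)) * sqrt T - \<tau> * sqrt T)\<^sup>2 / 2 \<le> - (T / 2) * (1 - 1000 * C * \<tau>)"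
      unfolding sq by simp
  qed
  ultimately show "exp (- (n * T / 256)) * sqrt 2 ^ k + exp (- ((1 - 3 / 2 * (2 * C * \<tau>)) * sqrt T - \<tau> * sqrt T)\<^sup>2 / 2)
      \<le> 2 * exp (- (T / 2) * (1 - 1000 * C * \<tau>))" by linarith
qed

text \<open>
  The regime in which the claimed rate is not vacuous.  The selection tolerance \<open>\<eta>\<close> is chosen so that
  the margin \<open>sqrt (n \<eta>)\<close> equals \<open>\<tau> \<parallel>\<theta>\<parallel>\<close>, which the rate absorbs.
\<close>

lemma sparse_clustering_guarantee:
  fixes \<kappa> lam \<tau> C :: real
  assumes C: "26 \<le> C" and \<theta>: "\<theta> \<in> carrier_vec p" and sparse: "norm_0 \<theta> \<le> s"
    and z: "z \<in> carrier_vec n" "\<And>i. i < n \<Longrightarrow> z $ i \<in> {- 1, 1}"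
    and Ln: "ln (real p) \<le> real n" and \<kappa>: "0 < \<kappa>" "norm_inf \<theta> \<le> \<kappa>" "\<kappa> \<le> sqrt (ln (real p))"
    and lam: "lam = C * (1 + \<kappa>) * sqrt (ln (real p) / real n)"
    and \<tau>: "0 \<le> \<tau>" "\<tau>\<^sup>2 = (real s)\<^sup>2 * ln (real p) * (1 + \<kappa>\<^sup>2) / (real n * vnorm \<theta> ^ 4)"
    and p: "9 \<le> p" and r1: "1 < vnorm \<theta>" and small: "1000 * C * \<tau> < 1"
  shows "with_prob_at_least (noise p n) (1 - 4 / real p - exp (- vnorm \<theta> / 2))
            (\<lambda>\<epsilon>. \<forall>zh. ssc_output lam (data_matrix \<theta> z \<epsilon>) zh \<longrightarrow>
               clustering_loss zh z
                 \<le> 2 * exp (- ((vnorm \<theta>)\<^sup>2 / 2) * (1 - 1000 * C * \<tau> - 1 / vnorm \<theta>)))"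
proof -
  interpret prob_space "noise p n" by (rule prob_space_noise)
  define \<theta>f where "\<theta>f = (\<lambda>j. if j < p then \<theta> $ j else 0)"
  define zf where "zf = (\<lambda>i. z $ i)"
  define S where "S = {j. j < p \<and> \<theta> $ j \<noteq> 0}"
  define T where "T = ip p \<theta>f \<theta>f"
  define L where "L = ln (real p)"
  define q where "q = sqrt (L / real n)"
  define h where "h = 2 * C * \<tau>"
  define r where "r = vnorm \<theta>"
  have S: "S \<subseteq> {..<p}" by (auto simp: S_def)
  have supp: "\<theta>f j = 0" if "j \<notin> S" for j using that by (auto simp: S_def \<theta>f_def)
  have cardS: "real (card S) \<le> real s" using sparse \<theta> by (auto simp: norm_0_def S_def)
  have r_sqrt: "r = sqrt T"
    unfolding r_def vnorm_def T_def using \<theta> by (simp add: scalar_prod_eq_ip) (simp add: ip_def \<theta>f_def)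
  have T_r: "T = r\<^sup>2" unfolding r_sqrt by (simp add: T_def ip_nonneg)
  have T1: "1 < T" using r1 unfolding T_r r_def[symmetric] by (simp add: power2_eq_square less_1_mult)
  have L1: "1 \<le> L"
  proof -
    have "exp 1 \<le> real p" using exp_le p by linarith
    then show ?thesis unfolding L_def using p by (subst ln_ge_iff) auto
  qed
  have Ln': "L \<le> real n" using Ln by (simp add: L_def)
  have npos: "0 < real n" using L1 Ln' by linarith
  have \<kappa>2: "\<kappa>\<^sup>2 \<le> L"
    using \<kappa> L1 power_mono[of \<kappa> "sqrt L" 2] by (simp add: L_def)
  have ent: "\<bar>\<theta>f j\<bar> \<le> \<kappa>" if "j < p" for j
  proof -
    have "\<bar>\<theta> $ j\<bar> \<le> norm_inf \<theta>"
      unfolding norm_inf_def using \<theta> that by (intro Max_ge) auto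
    then show ?thesis using \<kappa>(2) that by (simp add: \<theta>f_def)
  qed
  have Tk: "T \<le> real (card S) * \<kappa>\<^sup>2"
  proof -
    have "T = (\<Sum>j\<in>S. \<theta>f j * \<theta>f j)"
      unfolding T_def ip_def using S supp by (intro sum.mono_neutral_right) auto
    also have "\<dots> \<le> (\<Sum>j\<in>S. \<kappa>\<^sup>2)"
    proof (rule sum_mono)
      fix j assume "j \<in> S"
      then have "\<bar>\<theta>f j\<bar> \<le> \<kappa>" using ent S by auto
      then have "\<bar>\<theta>f j\<bar>\<^sup>2 \<le> \<kappa>\<^sup>2" by (intro power_mono) auto
      then show "\<theta>f j * \<theta>f j \<le> \<kappa>\<^sup>2" by (simp add: power2_eq_square)
    qed
    finally show ?thesis by simp
  qed
  have \<tau>2: "\<tau>\<^sup>2 = (real s)\<^sup>2 * L * (1 + \<kappa>\<^sup>2) / (real n * T\<^sup>2)"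
    unfolding \<tau>(2) T_r r_def L_def by simp
  note cons = signal_strength_consequences[OF L1 Ln' \<kappa>(1) \<kappa>2 T1 Tk of_nat_0_le_iff cardS \<tau>(1) \<tau>2 C small]
  have n256: "256 \<le> n" using cons(2) by simp
  note rate = error_rate_bound[OF cons(2) _ \<tau>(1) C small cons(3)]
  have q: "0 < q" "q \<le> 1" "real n * q\<^sup>2 = ln (real p)"
    using L1 Ln' npos unfolding q_def by (auto simp: L_def)
  have lam_q: "lam = C * (1 + \<kappa>) * q" by (simp add: lam q_def L_def)
  have lam_pos: "0 < lam" unfolding lam_q using C \<kappa> q by simp
  have zz: "zf i * zf i = 1" if "i < n" for i using z(2)[OF that] by (auto simp: zf_def)
  have h18: "h \<le> 1 / 18" using small \<tau> C unfolding h_def by linarith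
  have spiked: "spiked p S \<theta>f (gram n (obs zf \<theta>f \<epsilon>)) lam h T" if good: "moments_close p n zf q \<epsilon>" for \<epsilon>
  proof
    fix j k assume jk: "j < p" "k < p"
    have "\<bar>gram n (obs zf \<theta>f \<epsilon>) j k - of_bool (j = k) - \<theta>f j * \<theta>f k\<bar> \<le> 13 * (1 + \<kappa>) * q"
      using good jk npos q ent zz by (intro gram_deviation) (auto simp: moments_close_def)
    \<comment> \<open>the threshold \<open>26\<close> for \<open>C\<close> is twice the constant \<open>13\<close> of the deviation bound\<close>
    also have "\<dots> \<le> (C / 2) * (1 + \<kappa>) * q" using C \<kappa> q by (intro mult_right_mono) auto
    also have "\<dots> = lam / 2" by (simp add: lam_q)
    finally show "\<bar>gram n (obs zf \<theta>f \<epsilon>) j k - of_bool (j = k) - \<theta>f j * \<theta>f k\<bar> \<le> lam / 2" .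
  next
    show "lam * real (card S) \<le> h * T" using cons(4) by (simp add: lam_q q_def h_def)
  qed (use S supp lam_pos T_def T1 h18 in auto)
  define V where "V = aligned_unit p S \<theta>f ((1 - 3/2 * h) * sqrt T)"
  \<comment> \<open>the normalised signal is a candidate, so the dense sequence exists\<close>
  have "(\<lambda>j. (1 / r) * \<theta>f j) \<in> V"
  proof -
    have "ip p (\<lambda>j. (1 / r) * \<theta>f j) \<theta>f = sqrt T"
      unfolding ip_lin T_def[symmetric] using r1 unfolding r_def[symmetric] T_r by (simp add: power2_eq_square)
    moreover have "ip p (\<lambda>j. (1 / r) * \<theta>f j) (\<lambda>j. (1 / r) * \<theta>f j) = 1"
      unfolding ip_lin T_def[symmetric] using r1 unfolding r_def[symmetric] T_r by (simp add: power2_eq_square)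
    moreover have "(1 - 3/2 * h) * sqrt T \<le> 1 * sqrt T"
      using C \<tau> T1 unfolding h_def by (intro mult_right_mono) auto
    ultimately show ?thesis using supp by (auto simp: V_def aligned_unit_def)
  qed
  then have "V \<noteq> {}" by blast
  then obtain e :: "nat \<Rightarrow> nat \<Rightarrow> real" where e: "\<And>k. e k \<in> V"
    and dense: "\<And>(f :: (nat \<Rightarrow> real) \<Rightarrow> real) c u. continuous_on UNIV f \<Longrightarrow> (\<And>k. f (e k) \<le> c) \<Longrightarrow> u \<in> V \<Longrightarrow> f u \<le> c"
    by (rule countable_dense_sequence) blast
  define \<eta> where "\<eta> = \<tau>\<^sup>2 * T / real n"
  have \<eta>: "0 < \<eta>" using cons(1) T1 npos by (simp add: \<eta>_def)
  have t: "sqrt (real n * \<eta>) = \<tau> * sqrt T"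
    using npos \<tau>(1) by (simp add: \<eta>_def real_sqrt_mult)
  define F where "F i = {\<epsilon> \<in> space (noise p n). loo_fails p n zf \<theta>f S lam \<eta> (sqrt (real n * \<eta>)) e i \<epsilon>}" for i
  define b where "b = 2 * exp (- (T / 2) * (1 - 1000 * C * \<tau>))"
  have F: "F i \<in> events" "prob (F i) \<le> b" if i: "i < n" for i
  proof -
    have *: "sqrt (real n * \<eta>) \<le> (1 - 3/2 * h) * sqrt T" using rate(1) T1 unfolding t h_def by simp
    have e': "\<And>k. ip p (e k) (e k) = 1" "\<And>k. (1 - 3/2 * h) * sqrt T \<le> ip p (e k) \<theta>f"
      using e by (auto simp: V_def aligned_unit_def)
    have "64 \<le> n" using n256 by simp
    note bad = loo_fails_prob[where z = zf and \<theta> = \<theta>f and e = e and i = i, OF i this S supp zz[OF i] * e', of lam \<eta>, folded F_def]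
    show "F i \<in> events" by (rule bad(1))
    have "prob (F i) \<le> exp (- (real n * T / 256)) * sqrt 2 ^ card S + exp (- ((1 - 3/2 * h) * sqrt T - \<tau> * sqrt T)\<^sup>2 / 2)"
      using bad(2) unfolding t T_def[symmetric] .
    also have "\<dots> \<le> b" unfolding b_def h_def by (rule rate(2)) (use T1 in simp)
    finally show "prob (F i) \<le> b" .
  qed
  define R where "R = 2 * exp (- ((vnorm \<theta>)\<^sup>2 / 2) * (1 - 1000 * C * \<tau> - 1 / vnorm \<theta>))"
  have R: "R = b * exp (r / 2)"
  proof -
    have "- (r\<^sup>2 / 2) * (1 - 1000 * C * \<tau> - 1 / r) = - (r\<^sup>2 / 2) * (1 - 1000 * C * \<tau>) + r / 2"
      using r1 unfolding r_def[symmetric] by (simp add: field_simps power2_eq_square)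
    then show ?thesis unfolding R_def b_def r_def[symmetric] T_r by (simp only: exp_add mult.assoc)
  qed
  have bpos: "0 < b" by (simp add: b_def)
  have Rpos: "0 < R" by (simp add: R_def)
  \<comment> \<open>\<open>R\<close> exceeds the single failure probability by \<open>exp (r / 2)\<close>, which Markov turns into \<open>exp (- r / 2)\<close>\<close>
  define Many where "Many = {\<epsilon> \<in> space (noise p n). real n * R \<le> (\<Sum>i<n. indicator (F i) \<epsilon>)}"
  define Good where "Good = {\<epsilon> \<in> space (noise p n). moments_close p n zf q \<epsilon>}"
  have "prob Many \<le> real n * b / (real n * R)"
    unfolding Many_def using F npos Rpos by (intro markov_count) auto
  also have "\<dots> = exp (- r / 2)" using npos bpos by (simp add: R exp_minus field_simps)
  finally have Many_prob: "prob Many \<le> exp (- r / 2)" .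
  have Many_ev: "Many \<in> events"
  proof -
    have "(\<lambda>\<epsilon>. \<Sum>i<n. indicator (F i) \<epsilon> :: real) \<in> borel_measurable (noise p n)"
      using F(1) by (intro borel_measurable_sum borel_measurable_indicator) auto
    then show ?thesis unfolding Many_def by measurable
  qed
  have Good_ev: "Good \<in> events" unfolding Good_def by (rule sets_moments_close)
  have Good_prob: "1 - 4 / real p \<le> prob Good"
    unfolding Good_def using p zz q by (intro moments_close_prob) auto
  have "prob Good - prob Many \<le> prob (Good - Many)"
  proof -
    have "prob Good \<le> prob ((Good - Many) \<union> Many)"
      using Good_ev Many_ev by (intro finite_measure_mono) auto
    also have "\<dots> \<le> prob (Good - Many) + prob Many"
      using Good_ev Many_ev by (intro measure_Un_le) auto
    finally show ?thesis by simp
  qed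
  then have prob: "1 - 4 / real p - exp (- vnorm \<theta> / 2) \<le> prob (Good - Many)"
    using Good_prob Many_prob by (simp add: r_def)
  have "clustering_loss zh z \<le> R" if \<epsilon>: "\<epsilon> \<in> Good - Many" and out: "ssc_output lam (data_matrix \<theta> z \<epsilon>) zh" for \<epsilon> zh
  proof -
    let ?Y = "obs zf \<theta>f \<epsilon>"
    have X: "data_matrix \<theta> z \<epsilon> \<in> carrier_mat p n" using \<theta> z by (simp add: data_matrix_def)
    have Y: "data_matrix \<theta> z \<epsilon> $$ (j, i) = ?Y i j" if "i < n" "j < p" for i j
      using \<theta> z that by (simp add: data_matrix_def obs_def zf_def \<theta>f_def)
    obtain P u k where Pu: "pen_max p (gram n ?Y) lam P" "ip p u u = 1" "\<And>j. p \<le> j \<Longrightarrow> u j = 0"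
      "\<And>j. j < p \<Longrightarrow> (\<Sum>l<p. P j l * u l) = k * u j"
      "\<And>k' v. (\<And>j. j < p \<Longrightarrow> (\<Sum>l<p. P j l * v l) = k' * v j) \<Longrightarrow> ip p v v \<noteq> 0 \<Longrightarrow> k' \<le> k"
      and zh: "\<And>i. i < n \<Longrightarrow> zh $ i = sgn_pm (ip p (?Y i) u)"
      using ssc_outputE[OF out X Y] by blast
    have "\<exists>\<sigma> \<in> {- 1, 1}. \<forall>i<n. \<not> loo_fails p n zf \<theta>f S lam \<eta> (sqrt (real n * \<eta>)) e i \<epsilon> \<longrightarrow>
        \<sigma> * sgn_pm (ip p (?Y i) u) = zf i"
    proof (rule correct_unless_loo_fails)
      show "spiked p S \<theta>f (gram n ?Y) lam h T" using \<epsilon> by (intro spiked) (simp add: Good_def)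
      show "0 < n" using npos by simp
      show "zf i \<in> {- 1, 1}" if "i < n" for i using z(2)[OF that] by (simp add: zf_def)
      show "e k \<in> aligned_unit p S \<theta>f ((1 - 3/2 * h) * sqrt T)" for k using e by (simp add: V_def)
      show "f w \<le> c" if "continuous_on UNIV f" "\<And>k. f (e k) \<le> c"
        "w \<in> aligned_unit p S \<theta>f ((1 - 3/2 * h) * sqrt T)" for f :: "(nat \<Rightarrow> real) \<Rightarrow> real" and c w
        by (rule dense[of f c w]) (use that in \<open>simp_all add: V_def\<close>)
    qed (fact \<eta> Pu)+
    then obtain \<sigma> where \<sigma>: "\<sigma> \<in> {- 1, 1}"
      and ok: "\<And>i. i < n \<Longrightarrow> \<not> loo_fails p n zf \<theta>f S lam \<eta> (sqrt (real n * \<eta>)) e i \<epsilon> \<Longrightarrow> \<sigma> * sgn_pm (ip p (?Y i) u) = zf i"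
      by blast
    have "clustering_loss zh z \<le> (\<Sum>i<n. of_bool (\<sigma> * zh $ i \<noteq> z $ i)) / real n"
      using clustering_loss_le[OF \<sigma>, of zh z] z(1) by simp
    also have "\<dots> \<le> (\<Sum>i<n. indicator (F i) \<epsilon>) / real n"
    proof (intro divide_right_mono sum_mono)
      fix i assume "i \<in> {..<n}"
      then show "of_bool (\<sigma> * zh $ i \<noteq> z $ i) \<le> (indicator (F i) \<epsilon> :: real)"
        using ok[of i] zh[of i] \<epsilon> by (auto simp: indicator_def F_def Good_def zf_def)
    qed simp
    also have "\<dots> \<le> R" using \<epsilon> npos by (auto simp: Many_def Good_def not_le divide_le_eq mult.commute)
    finally show ?thesis .
  qed
  then show ?thesis
    unfolding with_prob_at_least_def R_def[symmetric] using prob Good_ev Many_ev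
    by (intro bexI[of _ "Good - Many"]) auto
qed

theorem theorem2p1:
  shows "\<exists>C0 > 0. \<forall>C \<ge> C0. \<exists>c > 0. \<exists>c' > 0.
    \<forall>(p :: nat) (n :: nat) (s :: nat) \<theta> z (\<kappa> :: real) (lam :: real) (\<tau> :: real).
      \<theta> \<in> carrier_vec p \<and> \<theta> \<noteq> 0\<^sub>v p \<and> norm_0 \<theta> \<le> s \<and>
      z \<in> carrier_vec n \<and> (\<forall>i<n. z $ i \<in> {- 1, 1}) \<and>
      ln (real p) \<le> real n \<and>
      0 < \<kappa> \<and> norm_inf \<theta> \<le> \<kappa> \<and> \<kappa> \<le> sqrt (ln (real p)) \<and>
      lam = C * (1 + \<kappa>) * sqrt (ln (real p) / real n) \<and>
      0 \<le> \<tau> \<and> \<tau>\<^sup>2 = (real s)\<^sup>2 * ln (real p) * (1 + \<kappa>\<^sup>2) / (real n * vnorm \<theta> ^ 4) \<and> \<tau>\<^sup>2 \<le> c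
      \<longrightarrow> with_prob_at_least (noise p n)
            (1 - 8 / real p - 2 * exp (- vnorm \<theta> / 2))
            (\<lambda>\<epsilon>. \<forall>zh. ssc_output lam (data_matrix \<theta> z \<epsilon>) zh \<longrightarrow>
               clustering_loss zh z
                 \<le> 2 * exp (- ((vnorm \<theta>)\<^sup>2 / 2) * (1 - c' * \<tau> - 1 / vnorm \<theta>)))"
proof (rule exI[of _ 26], intro conjI allI impI)
  fix C :: real assume C: "26 \<le> C"
  show "\<exists>c > 0. \<exists>c' > 0.
    \<forall>(p :: nat) (n :: nat) (s :: nat) \<theta> z (\<kappa> :: real) (lam :: real) (\<tau> :: real).
      \<theta> \<in> carrier_vec p \<and> \<theta> \<noteq> 0\<^sub>v p \<and> norm_0 \<theta> \<le> s \<and>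
      z \<in> carrier_vec n \<and> (\<forall>i<n. z $ i \<in> {- 1, 1}) \<and>
      ln (real p) \<le> real n \<and>
      0 < \<kappa> \<and> norm_inf \<theta> \<le> \<kappa> \<and> \<kappa> \<le> sqrt (ln (real p)) \<and>
      lam = C * (1 + \<kappa>) * sqrt (ln (real p) / real n) \<and>
      0 \<le> \<tau> \<and> \<tau>\<^sup>2 = (real s)\<^sup>2 * ln (real p) * (1 + \<kappa>\<^sup>2) / (real n * vnorm \<theta> ^ 4) \<and> \<tau>\<^sup>2 \<le> c
      \<longrightarrow> with_prob_at_least (noise p n)
            (1 - 8 / real p - 2 * exp (- vnorm \<theta> / 2))
            (\<lambda>\<epsilon>. \<forall>zh. ssc_output lam (data_matrix \<theta> z \<epsilon>) zh \<longrightarrow>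
               clustering_loss zh z
                 \<le> 2 * exp (- ((vnorm \<theta>)\<^sup>2 / 2) * (1 - c' * \<tau> - 1 / vnorm \<theta>)))"
  proof (rule exI[of _ 1], intro conjI, simp, rule exI[of _ "1000 * C"], intro conjI allI impI; (elim conjE)?)
    fix p n s :: nat and \<theta> z :: "real vec" and \<kappa> lam \<tau> :: real
    assume A: "\<theta> \<in> carrier_vec p" "\<theta> \<noteq> 0\<^sub>v p" "norm_0 \<theta> \<le> s" "z \<in> carrier_vec n" "\<forall>i<n. z $ i \<in> {- 1, 1}"
      "ln (real p) \<le> real n" "0 < \<kappa>" "norm_inf \<theta> \<le> \<kappa>" "\<kappa> \<le> sqrt (ln (real p))"
      "lam = C * (1 + \<kappa>) * sqrt (ln (real p) / real n)" "0 \<le> \<tau>"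
      "\<tau>\<^sup>2 = (real s)\<^sup>2 * ln (real p) * (1 + \<kappa>\<^sup>2) / (real n * vnorm \<theta> ^ 4)"
    let ?R = "2 * exp (- ((vnorm \<theta>)\<^sup>2 / 2) * (1 - 1000 * C * \<tau> - 1 / vnorm \<theta>))"
    let ?P = "\<lambda>\<epsilon>. \<forall>zh. ssc_output lam (data_matrix \<theta> z \<epsilon>) zh \<longrightarrow> clustering_loss zh z \<le> ?R"
    interpret prob_space "noise p n" by (rule prob_space_noise)
    have weaken: "with_prob_at_least (noise p n) (1 - 8 / real p - 2 * exp (- vnorm \<theta> / 2)) ?P"
      if "with_prob_at_least (noise p n) q ?P" "1 - 8 / real p - 2 * exp (- vnorm \<theta> / 2) \<le> q" for q
      using that unfolding with_prob_at_least_def by (meson order.trans)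
    have r0: "0 \<le> vnorm \<theta>" using A(1) by (simp add: vnorm_def scalar_prod_eq_ip ip_nonneg)
    \<comment> \<open>for \<open>p \<le> 8\<close> the probability bound is at most \<open>0\<close>; in the second case the rate is at least \<open>1\<close>\<close>
    consider "p \<le> 8" | "vnorm \<theta> \<le> 1 \<or> 1 \<le> 1000 * C * \<tau>" | "9 \<le> p" "1 < vnorm \<theta>" "1000 * C * \<tau> < 1"
      by linarith
    then show "with_prob_at_least (noise p n) (1 - 8 / real p - 2 * exp (- vnorm \<theta> / 2)) ?P"
    proof cases
      case 1
      have "0 < p" using A(1,2) by (cases p) auto
      then have "1 \<le> 8 / real p" using 1 by simp
      then have "1 - 8 / real p - 2 * exp (- vnorm \<theta> / 2) \<le> 0" by (smt (verit) exp_gt_zero)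
      moreover have "with_prob_at_least (noise p n) 0 ?P"
        unfolding with_prob_at_least_def by (intro bexI[of _ "{}"]) auto
      ultimately show ?thesis using weaken by blast
    next
      case 2
      have "1 - 1000 * C * \<tau> - 1 / vnorm \<theta> \<le> 0"
      proof (cases "1 \<le> 1000 * C * \<tau>")
        case True
        moreover have "0 \<le> 1 / vnorm \<theta>" using r0 by simp
        ultimately show ?thesis by linarith
      next
        case False
        have "vnorm \<theta> \<noteq> 0"
        proof
          assume "vnorm \<theta> = 0"
          then have "ip p (\<lambda>j. \<theta> $ j) (\<lambda>j. \<theta> $ j) = 0" using A(1) by (simp add: vnorm_def scalar_prod_eq_ip)
          then have "\<theta> = 0\<^sub>v p" using A(1) by (intro eq_vecI) (auto simp: ip_zero_iff)
          then show False using A(2) by simp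
        qed
        then have "1 \<le> 1 / vnorm \<theta>" using False 2 r0 by simp
        moreover have "0 \<le> 1000 * C * \<tau>" using C A(11) by simp
        ultimately show ?thesis by linarith
      qed
      then have "0 \<le> - ((vnorm \<theta>)\<^sup>2 / 2) * (1 - 1000 * C * \<tau> - 1 / vnorm \<theta>)"
        by (intro mult_nonpos_nonpos) auto
      then have "1 \<le> exp (- ((vnorm \<theta>)\<^sup>2 / 2) * (1 - 1000 * C * \<tau> - 1 / vnorm \<theta>))" by simp
      then have "clustering_loss zh z \<le> ?R" for zh using clustering_loss_le_1[of zh z] by linarith
      then have "with_prob_at_least (noise p n) 1 ?P"
        unfolding with_prob_at_least_def by (intro bexI[of _ "space (noise p n)"]) (auto simp: prob_space)
      moreover have "1 - 8 / real p - 2 * exp (- vnorm \<theta> / 2) \<le> 1"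
      proof -
        have "0 \<le> 8 / real p" by simp
        then show ?thesis by (smt (verit) exp_gt_zero)
      qed
      ultimately show ?thesis using weaken by blast
    next
      case 3
      have "with_prob_at_least (noise p n) (1 - 4 / real p - exp (- vnorm \<theta> / 2)) ?P"
        using A 3 C by (intro sparse_clustering_guarantee) auto
      moreover have "1 - 8 / real p - 2 * exp (- vnorm \<theta> / 2) \<le> 1 - 4 / real p - exp (- vnorm \<theta> / 2)"
      proof -
        have "4 / real p \<le> 8 / real p" by (intro divide_right_mono) auto
        then show ?thesis by (smt (verit) exp_gt_zero)
      qed
      ultimately show ?thesis using weaken by blast
    qed
  qed (use C in simp)
qed simp

end
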